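(* For each $n\geqslant2$, the following statements hold. (a) $\Upsilon_n^\infty(\mathbb{C})$ contains an open and dense subset of $\mathfrak{X}_n(\mathbb{C}^2)$; (b) $\Upsilon_n^\infty(\mathbb{R})$ is residual in $\mathfrak{X}_n(\mathbb{R}^2)$; and (c) for each $d\geqslant 1$, $\Upsilon_n^d(\mathbb{R})$ contains an open and dense subset of $\mathfrak{X}_n(\mathbb{R}^2)$. Moreover, all of these sets have full Lebesgue measure.
   Context: Let $\mathbb{K}\in\{\mathbb{R},\mathbb{C}\}$. A planar polynomial vector field $\mathcal{X}=(P,Q)$, with $P,Q\in\mathbb{K}[x,y]$, has degree $\max\{\deg P,\deg Q\}$. $\mathfrak{X}_n(\mathbb{K}^2)$ is the set of those of degree $n$, with the topology and Lebesgue measure coming from the identification with an open dense subset of $\mathbb{K}^{(n+1)(n+2)}$ via the coefficients of $P$ and $Q$. A polynomial $G\in\mathbb{C}[x,y]$ with $\deg G>0$ is an invariant algebraic curve of $\mathcal{X}$ if $P\,\partial_xG+Q\,\partial_yG=K G$ for some $K\in\mathbb{C}[x,y]$ (complex polynomials $G,K$ are allowed also when $\mathbb{K}=\mathbb{R}$). $\Upsilon_n^d(\mathbb{K})$ (resp. $\Upsilon_n^\infty(\mathbb{K})$) is the set of $\mathcal{X}\in\mathfrak{X}_n(\mathbb{K}^2)$ having no invariant algebraic curve of degree at most $d$ (resp. of any degree). A subset is residual if it contains a countable intersection of open dense subsets, and has full Lebesgue measure if its complement has zero Lebesgue measure. *)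

theory Defs
  imports
    "HOL-Analysis.Analysis"
    "HOL-Computational_Algebra.Polynomial"
    "HOL-Library.Extended_Nat"
begin

(* A polynomial G in K[x,y] is an element of (K[x])[y]: the coefficient of x^i y^j in G
   is coeff (coeff G j) i. *)

type_synonym 'a bipoly = "'a poly poly"
type_synonym 'a vector_field = "'a bipoly \<times> 'a bipoly"

(* The zero polynomial gets degree 0. *)
definition total_degree :: "'a::zero bipoly \<Rightarrow> nat" where
  "total_degree G = Max (insert 0 {i + j | i j. coeff (coeff G j) i \<noteq> 0})"

definition partial_x :: "'a::{comm_semiring_1,semiring_no_zero_divisors} bipoly \<Rightarrow> 'a bipoly" where
  "partial_x G = map_poly pderiv G"

definition partial_y :: "'a::{comm_semiring_1,semiring_no_zero_divisors} bipoly \<Rightarrow> 'a bipoly" where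
  "partial_y G = pderiv G"

definition vf_degree :: "'a::zero vector_field \<Rightarrow> nat" where
  "vf_degree X = max (total_degree (fst X)) (total_degree (snd X))"

definition vector_fields :: "nat \<Rightarrow> 'a::zero vector_field set" where
  "vector_fields n = {X. vf_degree X = n}"

(* The (n+1)(n+2) coefficients of a field of degree at most n: (False, i, j) stands for the
   coefficient of x^i y^j in P and (True, i, j) for that in Q. *)
definition coeff_index :: "nat \<Rightarrow> (bool \<times> nat \<times> nat) set" where
  "coeff_index n = {(b, i, j). i + j \<le> n}"

definition coeff_vector :: "nat \<Rightarrow> 'a::zero vector_field \<Rightarrow> (bool \<times> nat \<times> nat \<Rightarrow> 'a)" where
  "coeff_vector n X =
     (\<lambda>(b, i, j) \<in> coeff_index n. coeff (coeff (if b then snd X else fst X) j) i)"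

definition vf_topology :: "nat \<Rightarrow> 'a::{zero,topological_space} vector_field topology" where
  "vf_topology n = pullback_topology (vector_fields n) (coeff_vector n)
                     (product_topology (\<lambda>_. euclidean) (coeff_index n))"

definition open_dense_in :: "'a topology \<Rightarrow> 'a set \<Rightarrow> bool" where
  "open_dense_in T U \<longleftrightarrow> openin T U \<and> T closure_of U = topspace T"

definition residual_in :: "'a topology \<Rightarrow> 'a set \<Rightarrow> bool" where
  "residual_in T S \<longleftrightarrow> S \<subseteq> topspace T \<and>
     (\<exists>\<U>. countable \<U> \<and> (\<forall>U\<in>\<U>. open_dense_in T U) \<and> topspace T \<inter> \<Inter>\<U> \<subseteq> S)"

(* Lebesgue measure on K^((n+1)(n+2)) is the completion of the product of the Lebesgue-Borel
   measures of K, where the complex numbers carry planar Lebesgue measure. *)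
definition full_lebesgue_measure :: "nat \<Rightarrow> 'a::euclidean_space vector_field set \<Rightarrow> bool" where
  "full_lebesgue_measure n S \<longleftrightarrow> S \<subseteq> vector_fields n \<and>
     coeff_vector n ` (vector_fields n - S)
       \<in> null_sets (completion (PiM (coeff_index n) (\<lambda>_. lborel)))"

definition invariant_algebraic_curve :: "complex vector_field \<Rightarrow> complex bipoly \<Rightarrow> bool" where
  "invariant_algebraic_curve X G \<longleftrightarrow> total_degree G > 0 \<and>
     (\<exists>K. fst X * partial_x G + snd X * partial_y G = K * G)"

definition complexify :: "real vector_field \<Rightarrow> complex vector_field" where
  "complexify X = (map_poly (map_poly complex_of_real) (fst X),
                   map_poly (map_poly complex_of_real) (snd X))"

(* The bound d is an extended natural number; d = \<infinity> excludes invariant curves of every degree. *)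

definition Upsilon_complex :: "nat \<Rightarrow> enat \<Rightarrow> complex vector_field set" where
  "Upsilon_complex n d = {X \<in> vector_fields n.
     \<not> (\<exists>G. invariant_algebraic_curve X G \<and> enat (total_degree G) \<le> d)}"

definition Upsilon_real :: "nat \<Rightarrow> enat \<Rightarrow> real vector_field set" where
  "Upsilon_real n d = {X \<in> vector_fields n.
     \<not> (\<exists>G. invariant_algebraic_curve (complexify X) G \<and> enat (total_degree G) \<le> d)}"

lemma topspace_vf_topology [simp]: "topspace (vf_topology n) = vector_fields n"
  by (auto simp: vf_topology_def topspace_pullback_topology coeff_vector_def)

end

theory Submission
  imports Defs
    "HOL-Computational_Algebra.Field_as_Ring"
    "HOL-Computational_Algebra.Polynomial_Factorial"
    "HOL-Computational_Algebra.Formal_Power_Series"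
    "HOL-Computational_Algebra.Fundamental_Theorem_Algebra"
begin

text \<open>
  A field of degree n with generic leading part has n + 1 simple singular points on the line at
  infinity. If the ratio of eigenvalues at each of them is not a positive rational number, then a
  unique formal separatrix z = phi(u) = t + c1 u + c2 u^2 + ... (in the chart x = 1/u, y = z/u)
  crosses the line at infinity there, and an invariant curve of degree m becomes, in this chart and
  over the power series in u, a constant times a product of m factors z - phi. The coefficient of
  z^(m-1) is a polynomial of degree at most 1 in u, so the numbers c2 attached to the m factors add
  up to 0.

  The number c2 is an affine function of the homogeneous part of degree n - 2 of the field (this
  is where n >= 2 enters), and such a sum vanishes identically only if all eigenvalue ratios are
  rational, because these ratios add up to 1. Hence for each bound d on m the vanishing of one of
  the finitely many sums is a closed condition that holds only on a null set. Over the complex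
  numbers one may ask that no ratio be real, an open condition under which the factorization is
  available for all m at once. As the factors of an irreducible invariant curve are distinct, its
  degree is at most n + 1, so that finitely many sums suffice.
\<close>

subsection \<open>The chart at the points at infinity\<close>

text \<open>Why (b) is weaker than (a): at a real point at infinity of a real field the eigenvalue
  ratio is real, so asking for nonreal ratios is no option. A curve of degree m involves the
  resonances -a/e, where a \<le> m is a multiplicity and e \<ge> 1 an order of contact without
  bound. For a \<le> d these numbers accumulate only at 0, so that together with 0 they can be
  excluded by an open condition; for all a they are dense in the negative axis, and only a countable
  intersection over d remains.

  Density and null sets come from one device. A condition already known to be open is tested on
  curves x + \<tau>(s) in coefficient space: if for almost every x almost every s is good, then
  almost every x is good. Openness provides the measurability, and full measure gives density
  because nonempty open sets have positive measure. The conditions are obtained one after another,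
  each along a curve that leaves unchanged what the earlier ones read, so that each step is a
  question about one scalar s.\<close>

lemma total_degree_le_iff:
  "total_degree G \<le> N \<longleftrightarrow> (\<forall>i j. coeff (coeff G j) i \<noteq> 0 \<longrightarrow> i + j \<le> N)"
proof -
  have "{i + j | i j. coeff (coeff G j) i \<noteq> 0} \<subseteq>
      (\<lambda>(j, i). i + j) ` (SIGMA j:{..degree G}. {..degree (coeff G j)})"
    by (force intro: le_degree)
  then have "finite {i + j | i j. coeff (coeff G j) i \<noteq> 0}"
    by (rule finite_subset) auto
  then show ?thesis
    unfolding total_degree_def by auto
qed

lemma total_degree_leD: "total_degree G \<le> N \<Longrightarrow> N < i + j \<Longrightarrow> coeff (coeff G j) i = 0"
  by (metis total_degree_le_iff not_le)

lemma total_degree_leadE: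
  fixes G :: "'a::zero bipoly"
  assumes "G \<noteq> 0"
  obtains i j where "coeff (coeff G j) i \<noteq> 0" "i + j = total_degree G"
proof (rule ccontr)
  note witness = that
  assume neg: "\<not> thesis"
  obtain j0 i0 where nz: "coeff (coeff G j0) i0 \<noteq> 0"
    by (metis assms leading_coeff_0_iff)
  have less: "i + j < total_degree G" if "coeff (coeff G j) i \<noteq> 0" for i j
    using neg that witness[of j i] total_degree_le_iff[of G "total_degree G"] by fastforce
  then have "total_degree G \<le> total_degree G - 1"
    by (subst total_degree_le_iff) fastforce
  with less[OF nz] show False
    by simp
qed

text \<open>The polynomial u^N H(1/u, z/u) in z over the power series in u, for H of total degree at most N.\<close>
definition hom_poly :: "nat \<Rightarrow> complex bipoly \<Rightarrow> complex fps poly" where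
  "hom_poly N H = (\<Sum>j\<le>N. monom
     (Abs_fps (\<lambda>k. if j + k \<le> N then coeff (coeff H j) (N - j - k) else 0)) j)"

lemma hom_poly_nth:
  "fps_nth (coeff (hom_poly N H) j) k = (if j + k \<le> N then coeff (coeff H j) (N - j - k) else 0)"
  unfolding hom_poly_def coeff_sum by auto

lemma fps_poly_eqI:
  assumes "\<And>j k. fps_nth (coeff A j) k = fps_nth (coeff B j) k"
  shows "A = (B :: complex fps poly)"
  using assms by (auto intro!: poly_eqI fps_ext)

lemma hom_poly_0 [simp]: "hom_poly N 0 = 0"
  by (rule fps_poly_eqI) (simp add: hom_poly_nth)

lemma hom_poly_add: "hom_poly N (A + B) = hom_poly N A + hom_poly N B"
  by (rule fps_poly_eqI) (simp add: hom_poly_nth)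

lemma hom_poly_diff: "hom_poly N (A - B) = hom_poly N A - hom_poly N B"
  by (rule fps_poly_eqI) (simp add: hom_poly_nth)

lemma hom_poly_sum: "hom_poly N (sum f S) = (\<Sum>s\<in>S. hom_poly N (f s))"
  by (induction S rule: infinite_finite_induct) (auto simp: hom_poly_add)

lemma hom_poly_monom:
  assumes "i + j \<le> M"
  shows "hom_poly M (monom (monom b i) j) = monom (fps_const b * fps_X ^ (M - i - j)) j"
  by (rule fps_poly_eqI) (use assms in \<open>auto simp: hom_poly_nth\<close>)

lemma hom_poly_monom_mult:
  assumes "i + j \<le> M" "total_degree H \<le> N"
  shows "hom_poly (M + N) (monom (monom b i) j * H) = hom_poly M (monom (monom b i) j) * hom_poly N H"
proof (rule fps_poly_eqI)
  fix l k
  define e where "e = M - i - j"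
  have M: "M = e + i + j" using assms(1) by (simp add: e_def)
  show "fps_nth (coeff (hom_poly (M + N) (monom (monom b i) j * H)) l) k =
      fps_nth (coeff (hom_poly M (monom (monom b i) j) * hom_poly N H) l) k"
    unfolding hom_poly_monom[OF assms(1)] hom_poly_nth coeff_monom_mult e_def[symmetric]
    using total_degree_leD[OF assms(2)]
    by (auto simp: M hom_poly_nth mult.assoc fps_X_power_mult_nth coeff_monom_mult)
      (simp_all add: algebra_simps)
qed

lemma bipoly_as_sum_of_monoms:
  assumes "total_degree H \<le> N"
  shows "H = (\<Sum>j\<le>N. \<Sum>i\<le>N - j. monom (monom (coeff (coeff H j) i) i) j)"
proof (rule poly_eqI, rule poly_eqI)
  fix j i
  have "coeff (coeff (\<Sum>j\<le>N. \<Sum>i\<le>N - j. monom (monom (coeff (coeff H j) i) i) j) j) i =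
     (\<Sum>j'\<le>N. if j' = j then (\<Sum>i'\<le>N - j. if i' = i then coeff (coeff H j) i else 0) else 0)"
    unfolding coeff_sum by (intro sum.cong refl) (auto simp: coeff_sum intro!: sum.cong)
  also have "\<dots> = coeff (coeff H j) i"
    using total_degree_leD[OF assms, of i j] by (auto simp: not_le)
  finally show "coeff (coeff H j) i =
      coeff (coeff (\<Sum>j\<le>N. \<Sum>i\<le>N - j. monom (monom (coeff (coeff H j) i) i) j) j) i" ..
qed

lemma hom_poly_mult:
  assumes "total_degree K \<le> M" "total_degree H \<le> N"
  shows "hom_poly (M + N) (K * H) = hom_poly M K * hom_poly N H"
proof -
  have "hom_poly (M + N) (K * H) =
     hom_poly (M + N) ((\<Sum>j\<le>M. \<Sum>i\<le>M - j. monom (monom (coeff (coeff K j) i) i) j) * H)"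
    using bipoly_as_sum_of_monoms[OF assms(1)] by simp
  also have "\<dots> = (\<Sum>j\<le>M. \<Sum>i\<le>M - j. hom_poly M (monom (monom (coeff (coeff K j) i) i) j)) * hom_poly N H"
    unfolding sum_distrib_right hom_poly_sum
    by (intro sum.cong refl hom_poly_monom_mult assms) auto
  also have "\<dots> = hom_poly M K * hom_poly N H"
    unfolding hom_poly_sum[symmetric] bipoly_as_sum_of_monoms[OF assms(1), symmetric] ..
  finally show ?thesis .
qed

lemma hom_poly_increase_degree:
  assumes "total_degree H \<le> N"
  shows "hom_poly (j + N) H = smult (fps_X ^ j) (hom_poly N H)"
  by (rule fps_poly_eqI)
    (use total_degree_leD[OF assms] in \<open>auto simp: hom_poly_nth fps_X_power_mult_nth add.commute\<close>)

definition fps_slice :: "nat \<Rightarrow> complex fps poly \<Rightarrow> complex poly" where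
  "fps_slice k H = map_poly (\<lambda>f. fps_nth f k) H"

lemma coeff_fps_slice [simp]: "coeff (fps_slice k H) j = fps_nth (coeff H j) k"
  by (simp add: fps_slice_def coeff_map_poly)

lemma fps_slice_simps [simp]:
  "fps_slice k 0 = 0"
  "fps_slice k (A + B) = fps_slice k A + fps_slice k B"
  "fps_slice k (A - B) = fps_slice k A - fps_slice k B"
  "fps_slice k (pCons a A) = pCons (fps_nth a k) (fps_slice k A)"
  "fps_slice k (pderiv A) = pderiv (fps_slice k A)"
  "fps_slice 0 (A * B) = fps_slice 0 A * fps_slice 0 B"
proof -
  show "fps_slice k (pderiv A) = pderiv (fps_slice k A)"
    by (rule poly_eqI) (simp add: coeff_pderiv fps_mult_of_nat_nth flip: of_nat_Suc del: of_nat_Suc)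
  show "fps_slice 0 (A * B) = fps_slice 0 A * fps_slice 0 B"
    by (rule poly_eqI) (simp add: coeff_mult fps_sum_nth)
qed (auto intro!: poly_eqI simp: coeff_pCons split: nat.splits)

text \<open>The slice u = 0 is the leading form of \<open>H\<close> on the line x = 1, and a form of
  known degree is determined by its restriction to that line.\<close>

lemma hom_poly_top_nonzero:
  assumes "H \<noteq> 0"
  shows "fps_slice 0 (hom_poly (total_degree H) H) \<noteq> 0"
proof -
  obtain i j where ij: "coeff (coeff H j) i \<noteq> 0" "i + j = total_degree H"
    using total_degree_leadE[OF assms] .
  then have "total_degree H - j = i" "j \<le> total_degree H" by auto
  with ij(1) have "coeff (fps_slice 0 (hom_poly (total_degree H) H)) j \<noteq> coeff 0 j"
    by (simp add: hom_poly_nth)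
  then show ?thesis by (rule contrapos_nn) (simp only:)
qed

text \<open>Leading forms multiply, and their product is nonzero. This will bound the degree of a
  cofactor by n - 1.\<close>

lemma total_degree_mult:
  fixes A B :: "complex bipoly"
  assumes "A \<noteq> 0" "B \<noteq> 0"
  shows "total_degree A + total_degree B \<le> total_degree (A * B)"
proof (rule ccontr)
  assume less: "\<not> ?thesis"
  let ?S = "fps_slice 0 (hom_poly (total_degree A + total_degree B) (A * B))"
  have "?S = fps_slice 0 (hom_poly (total_degree A) A) * fps_slice 0 (hom_poly (total_degree B) B)"
    by (simp only: hom_poly_mult[OF order_refl order_refl] fps_slice_simps)
  then have nz: "?S \<noteq> 0"
    using hom_poly_top_nonzero[OF assms(1)] hom_poly_top_nonzero[OF assms(2)]
    by (simp only: mult_eq_0_iff simp_thms)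
  have "coeff ?S j = coeff 0 j" for j
    using less total_degree_leD[of "A * B" "total_degree (A * B)" "total_degree A + total_degree B - j" j]
    by (auto simp: hom_poly_nth)
  then have "?S = 0"
    by (intro poly_eqI)
  with nz show False ..
qed

text \<open>u d/du rather than d/du, because the line u = 0 at infinity is invariant; this
  derivation is diagonal on the powers of u.\<close>

definition fps_euler :: "complex fps \<Rightarrow> complex fps" where
  "fps_euler f = fps_X * fps_deriv f"

lemma fps_euler_nth: "fps_nth (fps_euler f) k = of_nat k * fps_nth f k"
  unfolding fps_euler_def by (cases k) auto

lemma fps_euler_simps [simp]:
  "fps_euler 0 = 0"
  "fps_euler 1 = 0"
  "fps_euler (f + g) = fps_euler f + fps_euler g"
  "fps_euler (- f) = - fps_euler f"
  "fps_euler (f * g) = fps_euler f * g + f * fps_euler g"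
  by (auto simp: fps_euler_def algebra_simps)

lemma fps_euler_sum: "fps_euler (sum f S) = (\<Sum>s\<in>S. fps_euler (f s))"
  by (induction S rule: infinite_finite_induct) auto

lemma coeff_map_fps_euler [simp]: "coeff (map_poly fps_euler H) j = fps_euler (coeff H j)"
  by (simp add: coeff_map_poly)

lemma map_fps_euler_mult:
  "map_poly fps_euler (A * B) = map_poly fps_euler A * B + A * map_poly fps_euler B"
  by (rule poly_eqI) (simp add: coeff_mult fps_euler_sum sum.distrib)

lemma fps_euler_poly:
  "fps_euler (poly H f) = poly (map_poly fps_euler H) f + poly (pderiv H) f * fps_euler f"
proof (induction H)
  case (pCons a H)
  have "map_poly fps_euler (pCons a H) = pCons (fps_euler a) (map_poly fps_euler H)"
    by (rule poly_eqI) (simp add: coeff_pCons split: nat.splits)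
  then show ?case
    by (simp add: pderiv_pCons pCons.IH algebra_simps)
qed simp

text \<open>The vector field - u P d/du + R d/dz in the chart at infinity.\<close>
definition vf_apply :: "complex fps poly \<Rightarrow> complex fps poly \<Rightarrow> complex fps poly \<Rightarrow> complex fps poly" where
  "vf_apply P R H = R * pderiv H - P * map_poly fps_euler H"

lemma vf_apply_mult: "vf_apply P R (A * B) = vf_apply P R A * B + A * vf_apply P R B"
  unfolding vf_apply_def map_fps_euler_mult by (simp add: pderiv_mult algebra_simps)

lemma vf_apply_smult_const: "vf_apply P R (smult (fps_const b) H) = smult (fps_const b) (vf_apply P R H)"
proof -
  have "map_poly fps_euler (smult (fps_const b) H) = smult (fps_const b) (map_poly fps_euler H)"
    by (rule fps_poly_eqI) (simp add: fps_euler_nth del: fps_euler_simps)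
  then show ?thesis
    by (simp add: vf_apply_def pderiv_smult smult_diff_right)
qed

text \<open>On the invariant line u = 0 only the d/dz component of the field survives.\<close>

lemma fps_slice_vf_apply: "fps_slice 0 (vf_apply P R H) = fps_slice 0 R * pderiv (fps_slice 0 H)"
proof -
  have "fps_slice 0 (map_poly fps_euler H) = 0"
    by (rule poly_eqI) (simp add: fps_euler_nth)
  then show ?thesis by (simp add: vf_apply_def)
qed

lemma poly_fps_nth_0: "fps_nth (poly H f) 0 = poly (fps_slice 0 H) (fps_nth f 0)"
  by (induction H) auto

lemma poly_fps_nth_1:
  "fps_nth (poly H f) 1 = poly (fps_slice 1 H) (fps_nth f 0)
     + fps_nth f 1 * poly (pderiv (fps_slice 0 H)) (fps_nth f 0)"
proof (induction H)
  case (pCons a H)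
  then show ?case by (simp add: fps_mult_nth_1' poly_fps_nth_0 pderiv_pCons algebra_simps)
qed simp

subsection \<open>Formal separatrices\<close>

lemma poly_fps_nth_2:
  "fps_nth (poly H f) 2 = poly (fps_slice 2 H) (fps_nth f 0)
     + fps_nth f 1 * poly (pderiv (fps_slice 1 H)) (fps_nth f 0)
     + fps_nth f 2 * poly (pderiv (fps_slice 0 H)) (fps_nth f 0)
     + (fps_nth f 1)\<^sup>2 * poly (pderiv (pderiv (fps_slice 0 H))) (fps_nth f 0) / 2"
proof (induction H)
  case (pCons a H)
  have mult2: "fps_nth (f * g) 2 = fps_nth f 0 * fps_nth g 2 + fps_nth f 1 * fps_nth g 1 + fps_nth f 2 * fps_nth g 0" for g
    by (simp add: fps_mult_nth numeral_2_eq_2)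
  have d1: "poly (pderiv (pCons b S)) x = poly S x + x * poly (pderiv S) x" for b x and S :: "complex poly"
    by (simp add: pderiv_pCons)
  have d2: "poly (pderiv (pderiv (pCons b S))) x =
      2 * poly (pderiv S) x + x * poly (pderiv (pderiv S)) x" for b x and S :: "complex poly"
    by (simp add: pderiv_pCons pderiv_add)
  have alg: "a2 + (f0 * (s2 + f1 * s1' + f2 * s0' + f1\<^sup>2 * s0'' / 2) + f1 * (s1 + f1 * s0') + f2 * s0) =
      a2 + f0 * s2 + f1 * (s1 + f0 * s1') + f2 * (s0 + f0 * s0') + f1\<^sup>2 * (2 * s0' + f0 * s0'') / 2"
    for a2 f0 f1 f2 s0 s1 s2 s0' s0'' s1' :: complex
    by (simp add: add_divide_distrib ring_distribs power2_eq_square)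
  have "fps_nth (poly (pCons a H) f) 2 = fps_nth a 2 + (fps_nth f 0 * fps_nth (poly H f) 2
      + fps_nth f 1 * fps_nth (poly H f) 1 + fps_nth f 2 * fps_nth (poly H f) 0)"
    by (simp only: poly_pCons fps_add_nth mult2)
  then show ?case
    by (simp only: pCons.IH poly_fps_nth_0 poly_fps_nth_1 fps_slice_simps d1 d2 alg poly_pCons)
qed simp


text \<open>Its zeros are the graphs z = f(u) that are invariant under the field - u P d/du + R d/dz.\<close>
definition sep_residue :: "complex fps poly \<Rightarrow> complex fps poly \<Rightarrow> complex fps \<Rightarrow> complex fps" where
  "sep_residue P R f = fps_euler f * poly P f + poly R f"

lemma poly_taylor2:
  fixes H :: "'a::idom poly"
  shows "\<exists>Q. poly H (f + h) = poly H f + h * poly (pderiv H) f + h\<^sup>2 * Q"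
proof (induction H)
  case (pCons a H)
  from pCons.IH obtain Q where Q: "poly H (f + h) = poly H f + h * poly (pderiv H) f + h\<^sup>2 * Q" ..
  show ?case
    by (rule exI[of _ "poly (pderiv H) f + (f + h) * Q"])
      (simp add: Q pderiv_pCons algebra_simps power2_eq_square)
qed auto

lemma poly_fps_cong:
  assumes "\<And>i. i < k \<Longrightarrow> fps_nth f i = fps_nth g i" "i < k"
  shows "fps_nth (poly H f) i = fps_nth (poly H g) i"
  using assms(2)
proof (induction H arbitrary: i)
  case (pCons a H)
  have "fps_nth (f * poly H f) i = fps_nth (g * poly H g) i"
    unfolding fps_mult_nth by (intro sum.cong refl) (use pCons assms(1) in auto)
  then show ?case by simp
qed simp

lemma sep_residue_cong:
  assumes "\<And>i. i < k \<Longrightarrow> fps_nth f i = fps_nth g i" "i < k"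
  shows "fps_nth (sep_residue P R f) i = fps_nth (sep_residue P R g) i"
proof -
  have "fps_nth (fps_euler f * poly P f) i = fps_nth (fps_euler g * poly P g) i"
    unfolding fps_mult_nth
    by (intro sum.cong refl) (use assms poly_fps_cong[OF assms(1)] in \<open>auto simp: fps_euler_nth\<close>)
  then show ?thesis
    using poly_fps_cong[OF assms] by (simp add: sep_residue_def)
qed

lemma fps_monomial_mult_nth:
  "fps_nth (fps_const c * fps_X ^ k * f) i = (if i < k then 0 else c * fps_nth f (i - k))"
  by (simp add: mult.assoc fps_X_power_mult_nth)

text \<open>Adding c u^k to f does not affect the residue below order k and changes its coefficient
  of order k by c times the quantity in \<open>nonres\<close>, so that c can be solved for.\<close>

lemma sep_residue_step:
  fixes f :: "complex fps"
  assumes k: "k \<ge> 1"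
    and zero: "\<And>i. i < k \<Longrightarrow> fps_nth (sep_residue P R f) i = 0"
    and nonres: "of_nat k * poly (fps_slice 0 P) (fps_nth f 0)
      + poly (pderiv (fps_slice 0 R)) (fps_nth f 0) \<noteq> 0"
  shows "\<exists>g. (\<forall>i<k. fps_nth g i = fps_nth f i) \<and> (\<forall>i\<le>k. fps_nth (sep_residue P R g) i = 0)"
proof -
  let ?d = "of_nat k * poly (fps_slice 0 P) (fps_nth f 0) + poly (pderiv (fps_slice 0 R)) (fps_nth f 0)"
  define c where "c = - fps_nth (sep_residue P R f) k / ?d"
  define h where "h = fps_const c * fps_X ^ k"
  obtain A where A: "poly P (f + h) = poly P f + h * poly (pderiv P) f + h\<^sup>2 * A"
    using poly_taylor2 by blast
  obtain B where B: "poly R (f + h) = poly R f + h * poly (pderiv R) f + h\<^sup>2 * B"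
    using poly_taylor2 by blast
  have euler_h: "fps_euler h = fps_const (of_nat k) * h"
    by (rule fps_ext) (auto simp: h_def fps_euler_nth simp del: fps_euler_simps)
  define C where "C = of_nat k * poly P f + poly (pderiv R) f + fps_euler f * poly (pderiv P) f
     + h * (of_nat k * poly (pderiv P) f + fps_euler f * A + of_nat k * h * A + B)"
  have "sep_residue P R (f + h) = sep_residue P R f + h * C"
    unfolding sep_residue_def A B C_def fps_euler_simps euler_h fps_of_nat
    by (simp add: algebra_simps power2_eq_square)
  then have expand: "fps_nth (sep_residue P R (f + h)) i = fps_nth (sep_residue P R f) i
      + (if i < k then 0 else c * fps_nth C (i - k))" for i
    by (simp add: h_def fps_monomial_mult_nth)
  have "fps_nth h 0 = 0"
    using k by (simp add: h_def)
  then have "fps_nth C 0 = ?d"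
    by (simp add: C_def poly_fps_nth_0 fps_euler_nth flip: fps_of_nat)
  then have "fps_nth (sep_residue P R (f + h)) i = 0" if "i \<le> k" for i
    using that zero nonres by (cases "i = k") (auto simp: expand c_def)
  moreover have "fps_nth (f + h) i = fps_nth f i" if "i < k" for i
    using that by (simp add: h_def)
  ultimately show ?thesis by blast
qed

text \<open>The approximations stabilize coefficient by coefficient, and the k-th coefficient of the
  residue depends only on the coefficients of the series up to k; hence the diagonal series is a
  zero.\<close>

lemma formal_separatrix_exists:
  assumes root: "poly (fps_slice 0 R) t = 0"
    and nonres: "\<And>k. k \<ge> 1 \<Longrightarrow> of_nat k * poly (fps_slice 0 P) t + poly (pderiv (fps_slice 0 R)) t \<noteq> 0"
  shows "\<exists>f. fps_nth f 0 = t \<and> sep_residue P R f = 0"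
proof -
  have "\<exists>F. \<forall>k. (fps_nth (F k) 0 = t \<and> (\<forall>i\<le>k. fps_nth (sep_residue P R (F k)) i = 0)) \<and>
      (\<forall>i\<le>k. fps_nth (F (Suc k)) i = fps_nth (F k) i)"
  proof (rule dependent_nat_choice)
    show "\<exists>f. fps_nth f 0 = t \<and> (\<forall>i\<le>0. fps_nth (sep_residue P R f) i = 0)"
      using root
      by (intro exI[of _ "fps_const t"]) (simp add: sep_residue_def poly_fps_nth_0 fps_euler_nth)
  next
    fix f k
    assume "fps_nth f 0 = t \<and> (\<forall>i\<le>k. fps_nth (sep_residue P R f) i = 0)"
    then obtain g where "\<forall>i<Suc k. fps_nth g i = fps_nth f i"
        "\<forall>i\<le>Suc k. fps_nth (sep_residue P R g) i = 0" "fps_nth f 0 = t"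
      using sep_residue_step[of "Suc k" P R f] nonres[of "Suc k"] by (auto simp: less_Suc_eq_le)
    then show "\<exists>g. (fps_nth g 0 = t \<and> (\<forall>i\<le>Suc k. fps_nth (sep_residue P R g) i = 0)) \<and>
        (\<forall>i\<le>k. fps_nth g i = fps_nth f i)"
      by (intro exI[of _ g]) auto
  qed
  then obtain F where F0: "\<And>k. fps_nth (F k) 0 = t"
    and Fres: "\<And>k. fps_nth (sep_residue P R (F k)) k = 0"
    and FSuc: "\<And>k i. i \<le> k \<Longrightarrow> fps_nth (F (Suc k)) i = fps_nth (F k) i"
    by auto
  define f where "f = Abs_fps (\<lambda>k. fps_nth (F k) k)"
  have stable: "fps_nth (F (i + m)) i = fps_nth (F i) i" for i m
    by (induction m) (auto simp: FSuc)
  have "fps_nth f i = fps_nth (F k) i" if "i < Suc k" for i k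
    using stable[of i "k - i"] that by (simp add: f_def)
  then have "fps_nth (sep_residue P R f) k = 0" for k
    using sep_residue_cong[of "Suc k" f "F k" k P R] Fres[of k] by simp
  then have "sep_residue P R f = 0"
    by (intro fps_ext) simp
  moreover have "fps_nth f 0 = t"
    by (simp add: f_def F0)
  ultimately show ?thesis by blast
qed

section \<open>Factorization of invariant polynomials along separatrices\<close>

text \<open>The logarithmic derivative h'/h has a simple pole at t whose residue is the order of
  vanishing, and r has a zero there that cancels the pole.\<close>

lemma cofactor_at_root:
  fixes r h \<kappa> :: "complex poly"
  assumes eq: "r * pderiv h = \<kappa> * h" and "h \<noteq> 0" and "poly r t = 0" and h: "poly h t = 0"
  shows "poly \<kappa> t = of_nat (order t h) * poly (pderiv r) t"
proof -
  define z where "z = [:-t, 1:]"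
  have z: "poly z t = 0" "pderiv z = 1" "z \<noteq> 0"
    by (auto simp: z_def pderiv_pCons)
  obtain w where w: "h = z ^ order t h * w"
    using order_1[of t h] by (auto simp: z_def)
  have "poly w t \<noteq> 0"
  proof
    assume "poly w t = 0"
    then obtain v where "w = z * v"
      by (auto simp: poly_eq_0_iff_dvd z_def)
    with w have "z ^ Suc (order t h) dvd h"
      by (metis dvd_triv_left mult.assoc power_Suc2)
    with order_2[OF \<open>h \<noteq> 0\<close>, of t] show False
      by (simp add: z_def)
  qed
  obtain s where s: "r = z * s"
    using \<open>poly r t = 0\<close> by (auto simp: poly_eq_0_iff_dvd z_def)
  obtain e where e: "order t h = Suc e"
    using h \<open>h \<noteq> 0\<close> by (metis not0_implies_Suc order_root)
  have h': "pderiv h = z ^ e * (of_nat (Suc e) * w + z * pderiv w)"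
  proof -
    have "pderiv (z ^ Suc e) = of_nat (Suc e) * z ^ e"
      by (simp only: pderiv_power_Suc z mult_1_right of_nat_poly) simp
    then show ?thesis
      by (subst w) (simp only: e pderiv_mult power_Suc ring_distribs mult_ac)
  qed
  have hw: "h = z ^ Suc e * w"
    using w by (simp only: e)
  have "z ^ Suc e * (s * (of_nat (Suc e) * w + z * pderiv w)) = r * pderiv h"
    by (simp only: h' s power_Suc mult_ac)
  also have "\<dots> = z ^ Suc e * (\<kappa> * w)"
    unfolding eq by (subst hw) (simp only: mult_ac)
  finally have "z ^ Suc e * (s * (of_nat (Suc e) * w + z * pderiv w)) = z ^ Suc e * (\<kappa> * w)" .
  then have "s * (of_nat (Suc e) * w + z * pderiv w) = \<kappa> * w"
    using z(3) by simp
  then have "poly s t * of_nat (Suc e) * poly w t = poly \<kappa> t * poly w t"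
    using z by (metis (no_types, lifting) add.right_neutral mult.assoc mult_zero_left poly_add poly_mult poly_of_nat)
  then have "poly \<kappa> t = of_nat (Suc e) * poly s t"
    using \<open>poly w t \<noteq> 0\<close> by (metis mult.commute mult_right_cancel)
  moreover have "poly (pderiv r) t = poly s t"
    by (simp add: s pderiv_mult z)
  ultimately show ?thesis by (simp add: e)
qed

text \<open>Along the separatrix, g = H(f) satisfies (u dg/du) P(f) = - \<kappa>(f) g. If g had
  finite order e, the lowest terms would give e p(t) + \<kappa>(t) = 0, whereas \<kappa>(t) = a
  r'(t) on the line at infinity, with a the multiplicity of t. This is the resonance that
  \<open>nonres\<close> excludes.\<close>

lemma root_on_separatrix:
  assumes sep: "sep_residue P R f = 0"
    and inv: "vf_apply P R H = \<kappa> * H"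
    and h: "fps_slice 0 H \<noteq> 0" "poly (fps_slice 0 H) (fps_nth f 0) = 0"
    and nonres: "\<And>e. e \<ge> 1 \<Longrightarrow> of_nat e * poly (fps_slice 0 P) (fps_nth f 0)
      + of_nat (order (fps_nth f 0) (fps_slice 0 H)) * poly (pderiv (fps_slice 0 R)) (fps_nth f 0) \<noteq> 0"
  shows "poly H f = 0"
proof (rule ccontr)
  let ?t = "fps_nth f 0"
  define g where "g = poly H f"
  assume "poly H f \<noteq> 0"
  then have "g \<noteq> 0" by (simp add: g_def)
  define e where "e = subdegree g"
  define w where "w = fps_shift e g"
  have g: "g = w * fps_X ^ e"
    unfolding w_def e_def by (rule subdegree_decompose)
  have w0: "fps_nth w 0 \<noteq> 0"
    using \<open>g \<noteq> 0\<close> by (simp add: w_def e_def)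
  have "fps_nth g 0 = 0"
    using h(2) by (simp add: g_def poly_fps_nth_0)
  then have "e \<ge> 1"
    using \<open>g \<noteq> 0\<close> unfolding e_def by (metis less_one linorder_not_less nth_subdegree_nonzero)
  have root: "poly (fps_slice 0 R) ?t = 0"
    using arg_cong[OF sep, of "\<lambda>x. fps_nth x 0"]
    by (simp add: sep_residue_def poly_fps_nth_0 fps_euler_nth)
  have Rf: "poly R f = - (fps_euler f * poly P f)"
    using sep by (simp add: sep_residue_def eq_neg_iff_add_eq_0 add.commute)
  have "poly (vf_apply P R H) f = poly \<kappa> f * g"
    by (simp add: inv g_def)
  then have "- (fps_euler f * poly P f) * poly (pderiv H) f - poly P f * poly (map_poly fps_euler H) f
      = poly \<kappa> f * g"
    by (simp add: vf_apply_def Rf)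
  moreover have "fps_euler g = poly (map_poly fps_euler H) f + poly (pderiv H) f * fps_euler f"
    by (simp only: g_def fps_euler_poly)
  ultimately have eq: "fps_euler g * poly P f = - poly \<kappa> f * g"
    by algebra
  have "fps_euler (fps_X ^ e) = of_nat e * fps_X ^ e"
    by (rule fps_ext) (simp add: fps_euler_nth)
  then have "fps_euler g = (fps_euler w + of_nat e * w) * fps_X ^ e"
    by (simp add: g algebra_simps)
  with eq have "((fps_euler w + of_nat e * w) * poly P f) * fps_X ^ e = (- poly \<kappa> f * w) * fps_X ^ e"
    by (simp add: g mult_ac)
  then have "(fps_euler w + of_nat e * w) * poly P f = - poly \<kappa> f * w"
    by (subst (asm) mult_cancel_right) auto
  from arg_cong[OF this, of "\<lambda>x. fps_nth x 0"]
  have "of_nat e * fps_nth w 0 * poly (fps_slice 0 P) ?t = - poly (fps_slice 0 \<kappa>) ?t * fps_nth w 0"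
    by (simp add: poly_fps_nth_0 fps_euler_nth flip: fps_of_nat)
  then have "of_nat e * poly (fps_slice 0 P) ?t + poly (fps_slice 0 \<kappa>) ?t = 0"
  proof -
    have "fps_nth w 0 * (of_nat e * poly (fps_slice 0 P) ?t + poly (fps_slice 0 \<kappa>) ?t) = 0"
      using \<open>of_nat e * fps_nth w 0 * poly (fps_slice 0 P) ?t = - poly (fps_slice 0 \<kappa>) ?t * fps_nth w 0\<close>
      by algebra
    with w0 show ?thesis by simp
  qed
  moreover have "poly (fps_slice 0 \<kappa>) ?t = of_nat (order ?t (fps_slice 0 H)) * poly (pderiv (fps_slice 0 R)) ?t"
    using arg_cong[OF inv, of "fps_slice 0"] h root
    by (intro cofactor_at_root) (auto simp: fps_slice_vf_apply)
  ultimately show False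
    using nonres[OF \<open>e \<ge> 1\<close>] by simp
qed

lemma fps_slice_monic:
  assumes "lead_coeff H = 1"
  shows "degree (fps_slice 0 H) = degree H" "lead_coeff (fps_slice 0 H) = 1"
proof -
  show deg: "degree (fps_slice 0 H) = degree H"
  proof (rule antisym)
    show "degree (fps_slice 0 H) \<le> degree H"
      by (intro degree_le) (simp add: coeff_eq_0)
    show "degree H \<le> degree (fps_slice 0 H)"
      by (intro le_degree) (simp add: assms)
  qed
  show "lead_coeff (fps_slice 0 H) = 1"
    unfolding deg using assms by simp
qed

text \<open>A zero t of \<open>H\<close> on u = 0 is a singular point, so \<open>H\<close> vanishes
  on the separatrix through t. The linear factor split off is itself invariant, hence so is the
  quotient, and induction applies. A multiplicity cannot exceed the degree, whence the bound a \<le>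
  d. Reading the second coefficient from \<open>pCons 0 H\<close> at \<open>degree H\<close> is
  correct in degree 0 too.\<close>

lemma monic_invariant_factorization:
  fixes \<phi> :: "complex \<Rightarrow> complex fps"
  assumes sep: "\<And>t. poly (fps_slice 0 R) t = 0 \<Longrightarrow> fps_nth (\<phi> t) 0 = t \<and> sep_residue P R (\<phi> t) = 0"
    and nonres: "\<And>t e a. poly (fps_slice 0 R) t = 0 \<Longrightarrow> 1 \<le> e \<Longrightarrow> 1 \<le> a \<Longrightarrow> a \<le> d \<Longrightarrow>
       of_nat e * poly (fps_slice 0 P) t + of_nat a * poly (pderiv (fps_slice 0 R)) t \<noteq> 0"
    and R: "fps_slice 0 R \<noteq> 0"
    and "lead_coeff H = 1" "degree H \<le> d" "vf_apply P R H = \<kappa> * H"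
  shows "\<exists>ts. set ts \<subseteq> {t. poly (fps_slice 0 R) t = 0} \<and> length ts = degree H \<and>
     H = (\<Prod>t\<leftarrow>ts. [:- \<phi> t, 1:]) \<and> coeff (pCons 0 H) (degree H) = - (\<Sum>t\<leftarrow>ts. \<phi> t)"
  using assms(4-)
proof (induction "degree H" arbitrary: H \<kappa>)
  case 0
  then have "H = 1"
    by (metis degree_eq_zeroE lead_coeff_pCons(2) one_pCons)
  then show ?case
    by (intro exI[of _ "[]"]) simp
next
  case (Suc m)
  let ?h = "fps_slice 0 H" and ?r = "fps_slice 0 R"
  note slice = fps_slice_monic[OF Suc.prems(1)]
  have h0: "?h \<noteq> 0"
    using slice(2) by (metis leading_coeff_0_iff zero_neq_one)
  have "\<not> constant (poly ?h)"
    using slice(1) Suc.hyps(2) by (simp add: constant_degree)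
  then obtain t where t: "poly ?h t = 0"
    using fundamental_theorem_of_algebra by blast
  have eq: "?r * pderiv ?h = fps_slice 0 \<kappa> * ?h"
    using arg_cong[OF Suc.prems(3), of "fps_slice 0"] by (simp add: fps_slice_vf_apply)
  \<comment> \<open>Where r does not vanish, r h' = \<kappa> h would force h' to vanish at least to
    the order of h, but differentiation lowers the order of a zero.\<close>
  have root: "poly ?r t = 0"
  proof (rule ccontr)
    assume nr: "poly ?r t \<noteq> 0"
    have "pderiv ?h \<noteq> 0"
      using slice(1) Suc.hyps(2) by (simp add: pderiv_eq_0_iff)
    then have lhs: "?r * pderiv ?h \<noteq> 0" using R by simp
    have "order t ?h \<le> order t (fps_slice 0 \<kappa> * ?h)"
      using lhs unfolding eq by (simp add: order_mult)
    also have "\<dots> = order t (pderiv ?h)"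
      unfolding eq[symmetric] using lhs order_mult[OF lhs] nr by (simp add: order_0I)
    finally show False
      using order_pderiv[OF h0 t] by simp
  qed
  have "order t ?h \<le> degree ?h"
    by (rule order_degree[OF h0])
  then have ord: "1 \<le> order t ?h" "order t ?h \<le> d"
    using slice(1) Suc.prems(2) h0 t by (auto simp: order_root Suc_le_eq)
  from sep[OF root] have \<phi>: "fps_nth (\<phi> t) 0 = t" "sep_residue P R (\<phi> t) = 0" by auto
  have "poly H (\<phi> t) = 0"
    by (rule root_on_separatrix[OF \<phi>(2) Suc.prems(3) h0]) (use nonres[OF root] ord t \<phi>(1) in auto)
  then obtain H' where H': "H = [:- \<phi> t, 1:] * H'"
    by (auto simp: poly_eq_0_iff_dvd)
  have lead': "lead_coeff H' = 1"
    using Suc.prems(1) unfolding H' lead_coeff_mult by simp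
  then have "H' \<noteq> 0" by auto
  then have deg: "degree H = Suc (degree H')"
    unfolding H' by (subst degree_mult_eq) auto
  have vf_lin: "vf_apply P R [:- \<phi> t, 1:] = R + P * [:fps_euler (\<phi> t):]"
  proof -
    have "map_poly fps_euler [:- \<phi> t, 1:] = - [:fps_euler (\<phi> t):]"
      by (rule poly_eqI) (auto simp: coeff_pCons split: nat.splits)
    then show ?thesis
      by (simp add: vf_apply_def pderiv_pCons)
  qed
  have "poly (vf_apply P R [:- \<phi> t, 1:]) (\<phi> t) = 0"
    using \<phi>(2) unfolding vf_lin by (simp add: sep_residue_def algebra_simps)
  then obtain \<mu> where \<mu>: "vf_apply P R [:- \<phi> t, 1:] = [:- \<phi> t, 1:] * \<mu>"
    unfolding poly_eq_0_iff_dvd by (elim dvdE)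
  have "[:- \<phi> t, 1:] * vf_apply P R H' = [:- \<phi> t, 1:] * ((\<kappa> - \<mu>) * H')"
    using Suc.prems(3) unfolding H' vf_apply_mult \<mu> by (simp only: algebra_simps)
  then have "vf_apply P R H' = (\<kappa> - \<mu>) * H'"
    by (subst (asm) mult_cancel_left) auto
  then obtain ts where ts: "set ts \<subseteq> {t. poly ?r t = 0}" "length ts = degree H'"
      "H' = (\<Prod>t\<leftarrow>ts. [:- \<phi> t, 1:])" "coeff (pCons 0 H') (degree H') = - (\<Sum>t\<leftarrow>ts. \<phi> t)"
    using Suc.hyps(1)[of H'] Suc.hyps(2) deg lead' Suc.prems(2) by auto
  have "H = smult (- \<phi> t) H' + pCons 0 H'"
    by (simp add: H')
  then have "coeff (pCons 0 H) (degree H) = - (\<Sum>t\<leftarrow>t # ts. \<phi> t)"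
    using ts(4) lead' unfolding deg by simp
  then show ?case
    using ts root deg by (intro exI[of _ "t # ts"]) (simp add: H')
qed

section \<open>Derivatives in the chart and repeated separatrices\<close>

lemma hom_poly_pderiv:
  "pderiv (hom_poly m G) = (if m = 0 then 0 else hom_poly (m - 1) (partial_y G))"
  by (rule fps_poly_eqI)
    (auto simp: hom_poly_nth coeff_pderiv partial_y_def of_nat_poly simp flip: fps_of_nat of_nat_Suc)

text \<open>Euler's identity x F_x + y F_y + w F_w = m F for the homogenization F of
  \<open>G\<close>, at the point (1, z, u).\<close>

lemma hom_poly_partial_x:
  assumes "m > 0"
  shows "hom_poly (m - 1) (partial_x G) =
    of_nat m * hom_poly m G - pCons 0 (pderiv (hom_poly m G)) - map_poly fps_euler (hom_poly m G)"
proof (rule fps_poly_eqI)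
  fix j k
  show "fps_nth (coeff (hom_poly (m - 1) (partial_x G)) j) k = fps_nth (coeff (of_nat m * hom_poly m G
     - pCons 0 (pderiv (hom_poly m G)) - map_poly fps_euler (hom_poly m G)) j) k"
  proof (cases "j + k \<le> m")
    case True
    then obtain l where m: "m = j + k + l"
      by (auto simp: le_iff_add)
    have euler: "fps_nth (coeff (pCons 0 (pderiv (hom_poly m G))) j) k = of_nat j * coeff (coeff G j) l"
      by (cases j) (auto simp: hom_poly_nth coeff_pderiv m simp flip: fps_of_nat of_nat_Suc)
    have "fps_nth (coeff (hom_poly (m - 1) (partial_x G)) j) k = of_nat l * coeff (coeff G j) l"
      using assms
      by (cases l) (auto simp: hom_poly_nth partial_x_def coeff_map_poly coeff_pderiv m simp flip: of_nat_Suc)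
    then show ?thesis
      by (simp only: coeff_diff fps_sub_nth euler coeff_map_fps_euler fps_euler_nth)
        (simp add: hom_poly_nth m of_nat_poly algebra_simps flip: fps_of_nat)
  next
    case False
    then show ?thesis
      by (cases j) (auto simp: hom_poly_nth coeff_pderiv fps_euler_nth of_nat_poly simp flip: fps_of_nat of_nat_Suc)
  qed
qed

lemma total_degree_mult_le:
  fixes A B :: "complex bipoly"
  assumes "total_degree A \<le> N" "total_degree B \<le> M"
  shows "total_degree (A * B) \<le> N + M"
  unfolding total_degree_le_iff
proof (intro allI impI, rule ccontr)
  fix i j assume ij: "\<not> i + j \<le> N + M"
  have "coeff (coeff A l) k * coeff (coeff B (j - l)) (i - k) = 0" if "l \<le> j" "k \<le> i" for l k
    using that ij total_degree_leD[OF assms(1), of k l] total_degree_leD[OF assms(2), of "i - k" "j - l"]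
    by (cases "N < k + l") auto
  then have "coeff (coeff (A * B) j) i = 0"
    unfolding coeff_mult coeff_sum by (intro sum.neutral ballI) simp
  moreover assume "coeff (coeff (A * B) j) i \<noteq> 0"
  ultimately show False by simp
qed

text \<open>A nonzero polynomial of least degree among those vanishing on the separatrix pseudo-divides G.\<close>
lemma prime_elem_simple_separatrix:
  assumes G: "prime_elem (G :: complex bipoly)" "degree G > 0"
    and G0: "total_degree G \<le> N" "poly (hom_poly N G) f = 0"
    and G1: "total_degree (pderiv G) \<le> M" "poly (hom_poly M (pderiv G)) f = 0"
  shows False
proof -
  \<comment> \<open>\<open>I\<close> is the ideal of curves containing the separatrix. Raising N
    only multiplies by a power of u, so that two members can be subtracted with a common
    bound.\<close>
  define I where "I = {H :: complex bipoly. \<exists>N. total_degree H \<le> N \<and> poly (hom_poly N H) f = 0}"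
  have I_mult: "A * B \<in> I" if "A \<in> I" for A B
  proof -
    obtain N where N: "total_degree A \<le> N" "poly (hom_poly N A) f = 0"
      using \<open>A \<in> I\<close> by (auto simp: I_def)
    have "poly (hom_poly (N + total_degree B) (A * B)) f = 0"
      using N by (simp add: hom_poly_mult)
    moreover have "total_degree (A * B) \<le> N + total_degree B"
      by (intro total_degree_mult_le N order_refl)
    ultimately show ?thesis by (auto simp: I_def)
  qed
  have I_diff: "A - B \<in> I" if "A \<in> I" "B \<in> I" for A B
  proof -
    obtain N M where N: "total_degree A \<le> N" "poly (hom_poly N A) f = 0"
      and M: "total_degree B \<le> M" "poly (hom_poly M B) f = 0"
      using \<open>A \<in> I\<close> \<open>B \<in> I\<close> unfolding I_def by blast
    have "poly (hom_poly (M + N) (A - B)) f = 0"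
      using N M hom_poly_increase_degree[OF N(1), of M] hom_poly_increase_degree[OF M(1), of N]
      by (simp add: hom_poly_diff add.commute)
    moreover have "total_degree (A - B) \<le> M + N"
      unfolding total_degree_le_iff
    proof (intro allI impI, rule ccontr)
      fix i j assume "coeff (coeff (A - B) j) i \<noteq> 0" "\<not> i + j \<le> M + N"
      then show False
        using total_degree_leD[OF N(1), of i j] total_degree_leD[OF M(1), of i j] by simp
    qed
    ultimately show ?thesis by (auto simp: I_def)
  qed
  \<comment> \<open>The derivative in y supplies a nonzero member of smaller degree in y than
    G.\<close>
  have "\<exists>H. H \<in> I \<and> H \<noteq> 0 \<and> degree H < degree G"
    using G(2) G1
    by (intro exI[of _ "pderiv G"]) (auto simp: I_def pderiv_eq_0_iff degree_pderiv)
  then obtain H0 where "H0 \<in> I \<and> H0 \<noteq> 0 \<and> degree H0 < degree G" ..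
  from ex_has_least_nat[where P = "\<lambda>H. H \<in> I \<and> H \<noteq> 0 \<and> degree H < degree G" and m = degree, OF this]
  obtain H where H: "H \<in> I" "H \<noteq> 0" "degree H < degree G"
    and "\<And>A. A \<in> I \<Longrightarrow> A \<noteq> 0 \<Longrightarrow> degree A < degree G \<Longrightarrow> degree H \<le> degree A"
    by blast
  then have min: "A = 0" if "A \<in> I" "degree A < degree H" for A
    using that by (metis less_trans not_le)
  \<comment> \<open>A nonzero polynomial in x alone turns into a nonzero polynomial in u and so
    vanishes on no separatrix.\<close>
  have degH: "degree H > 0"
  proof (rule ccontr)
    assume "\<not> degree H > 0"
    then obtain g where g: "H = [:g:]"
      by (auto elim: degree_eq_zeroE)
    obtain L where L: "total_degree H \<le> L" "poly (hom_poly L H) f = 0"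
      using H(1) by (auto simp: I_def)
    have hom: "hom_poly L H = [:Abs_fps (\<lambda>k. if k \<le> L then coeff g (L - k) else 0):]"
      by (rule fps_poly_eqI) (auto simp: hom_poly_nth g coeff_pCons split: nat.splits)
    have "(if k \<le> L then coeff g (L - k) else 0) = 0" for k
      using arg_cong[OF L(2), of "\<lambda>x. fps_nth x k"] by (simp add: hom)
    then have small: "coeff g i = 0" if "i \<le> L" for i
      using that by (metis diff_diff_cancel diff_le_self)
    have "coeff g i = 0" for i
      using small[of i] total_degree_leD[OF L(1), of i 0] by (cases "i \<le> L") (auto simp: g)
    then have "g = 0" by (intro poly_eqI) simp
    with g H(2) show False by simp
  qed
  obtain q r where qr: "pseudo_divmod G H = (q, r)" by fastforce
  define c where "c = lead_coeff H ^ (Suc (degree G) - degree H)"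
  have c: "c \<noteq> 0" using H(2) by (simp add: c_def)
  have div: "smult c G = H * q + r" and r: "r = 0 \<or> degree r < degree H"
    using pseudo_divmod[OF H(2) qr] by (auto simp: c_def)
  have "G \<in> I" using G0 by (auto simp: I_def)
  then have "G * [:c:] - H * q \<in> I"
    using H(1) by (intro I_diff I_mult)
  moreover have "G * [:c:] - H * q = r"
    using div by simp
  ultimately have "r = 0"
    using r min by auto
  then have div: "G * [:c:] = H * q" using div by simp
  \<comment> \<open>Here c is a nonzero element of C[x]. The prime G cannot divide H, which has
    smaller degree in y; if it divided q, then H would divide c in spite of its positive degree in
    y.\<close>
  then have "G dvd H * q" by (metis dvd_triv_left)
  then consider "G dvd H" | "G dvd q"
    using G(1) by (auto simp: prime_elem_dvd_mult_iff)
  then show False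
  proof cases
    case 1
    then show False using H(2,3) by (auto dest: dvd_imp_degree_le)
  next
    case 2
    then obtain s where "q = G * s" ..
    with div have "G * [:c:] = G * (H * s)" by (simp add: mult_ac)
    then have hs: "[:c:] = H * s"
      using G(1) by (subst (asm) mult_cancel_left) auto
    then have "s \<noteq> 0" using c by auto
    have "degree [:c:] = degree H + degree s"
      unfolding hs by (rule degree_mult_eq) (use \<open>s \<noteq> 0\<close> H(2) in auto)
    then show False using degH by simp
  qed
qed

subsection \<open>Invariant curves and the second coefficients of the separatrices\<close>

text \<open>The homogeneous part of degree N of P (of Q, if b), restricted to the line x = 1.\<close>
definition form_poly :: "(bool \<times> nat \<times> nat \<Rightarrow> complex) \<Rightarrow> bool \<Rightarrow> nat \<Rightarrow> complex poly" where
  "form_poly c b N = (\<Sum>j\<le>N. monom (c (b, N - j, j)) j)"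

text \<open>x Q_N - y P_N on the line x = 1, for the degree N parts P_N and Q_N; for N = n the roots are the singular
  points at infinity.\<close>
definition radial_poly :: "(bool \<times> nat \<times> nat \<Rightarrow> complex) \<Rightarrow> nat \<Rightarrow> complex poly" where
  "radial_poly c N = form_poly c True N - pCons 0 (form_poly c False N)"

text \<open>The coefficient of u^2 of the separatrix through the root t of the radial polynomial, found by
  comparing coefficients of u and of u^2; the local c1 is its coefficient of u.\<close>
definition sep_coeff :: "(bool \<times> nat \<times> nat \<Rightarrow> complex) \<Rightarrow> nat \<Rightarrow> complex \<Rightarrow> complex" where
  "sep_coeff c n t =
    (let p = form_poly c False n; r = radial_poly c n;
         c1 = - poly (radial_poly c (n - 1)) t / (poly p t + poly (pderiv r) t)
     in - (poly (radial_poly c (n - 2)) t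
           + c1 * (poly (pderiv (radial_poly c (n - 1))) t + poly (form_poly c False (n - 1)) t)
           + c1\<^sup>2 * (poly (pderiv p) t + poly (pderiv (pderiv r)) t / 2))
         / (2 * poly p t + poly (pderiv r) t))"

definition vf_coeffs :: "complex vector_field \<Rightarrow> bool \<times> nat \<times> nat \<Rightarrow> complex" where
  "vf_coeffs X = (\<lambda>(b, i, j). coeff (coeff (if b then snd X else fst X) j) i)"

lemma coeff_form_poly: "coeff (form_poly c b N) j = (if j \<le> N then c (b, N - j, j) else 0)"
  by (auto simp: form_poly_def coeff_sum)

lemma coeff_radial_poly_Suc: "coeff (radial_poly c N) (Suc N) = - c (False, 0, N)"
  by (simp add: radial_poly_def coeff_form_poly)

lemma degree_radial_poly_le: "degree (radial_poly c N) \<le> Suc N"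
  by (rule degree_le) (auto simp: radial_poly_def coeff_form_poly coeff_pCons split: nat.splits)

lemma degree_radial_poly:
  assumes "c (False, 0, N) \<noteq> 0"
  shows "degree (radial_poly c N) = Suc N"
  using degree_radial_poly_le assms by (intro antisym le_degree) (auto simp: coeff_radial_poly_Suc)

lemma lead_coeff_radial_poly:
  assumes "c (False, 0, N) \<noteq> 0"
  shows "lead_coeff (radial_poly c N) = - c (False, 0, N)"
  by (simp add: degree_radial_poly[of c N, OF assms] coeff_radial_poly_Suc)

lemma fps_slice_hom_poly:
  assumes "k \<le> n"
  shows "fps_slice k (hom_poly n (fst X)) = form_poly (vf_coeffs X) False (n - k)"
    "fps_slice k (hom_poly n (snd X)) = form_poly (vf_coeffs X) True (n - k)"
  using assms by (auto intro!: poly_eqI simp: hom_poly_nth coeff_form_poly vf_coeffs_def le_diff_conv2 add.commute)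

lemma sep_coeff_eq_nth:
  assumes f: "sep_residue P R f = 0" "fps_nth f 0 = t"
    and P: "\<And>k. k \<le> n \<Longrightarrow> fps_slice k P = form_poly c False (n - k)"
    and R: "\<And>k. k \<le> n \<Longrightarrow> fps_slice k R = radial_poly c (n - k)"
    and n: "n \<ge> 2"
    and nz: "poly (form_poly c False n) t + poly (pderiv (radial_poly c n)) t \<noteq> 0"
      "2 * poly (form_poly c False n) t + poly (pderiv (radial_poly c n)) t \<noteq> 0"
  shows "fps_nth f 2 = sep_coeff c n t"
proof -
  define p p' p1 r' r'' r1 r1' r2 where
    "p = poly (form_poly c False n) t" "p' = poly (pderiv (form_poly c False n)) t"
    "p1 = poly (form_poly c False (n - 1)) t"
    "r' = poly (pderiv (radial_poly c n)) t" "r'' = poly (pderiv (pderiv (radial_poly c n))) t"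
    "r1 = poly (radial_poly c (n - 1)) t" "r1' = poly (pderiv (radial_poly c (n - 1))) t"
    "r2 = poly (radial_poly c (n - 2)) t"
  note defs = this
  let ?c1 = "fps_nth f 1" and ?c2 = "fps_nth f 2"
  have P0: "fps_nth (poly P f) 0 = p" and P1: "fps_nth (poly P f) 1 = p1 + ?c1 * p'"
    using n P[of 0] P[of 1] f(2) by (simp_all add: poly_fps_nth_0 poly_fps_nth_1 defs del: One_nat_def)
  have R1: "fps_nth (poly R f) 1 = r1 + ?c1 * r'"
    using n R[of 0] R[of 1] f(2) by (simp add: poly_fps_nth_1 defs del: One_nat_def)
  have R2: "fps_nth (poly R f) 2 = r2 + ?c1 * r1' + ?c2 * r' + ?c1\<^sup>2 * r'' / 2"
    using n R[of 0] R[of 1] R[of 2] f(2) by (simp add: poly_fps_nth_2 defs del: One_nat_def)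
  have "fps_nth (fps_euler f * poly P f) 1 = ?c1 * p"
    by (simp only: mult_nth_1 fps_euler_nth P0 P1) simp
  then have eq1: "?c1 * p + (r1 + ?c1 * r') = 0"
    using arg_cong[OF f(1), of "\<lambda>x. fps_nth x 1"] by (simp only: sep_residue_def fps_add_nth fps_zero_nth R1)
  have nth2: "fps_nth (a * b) 2 = fps_nth a 0 * fps_nth b 2 + fps_nth a 1 * fps_nth b 1 + fps_nth a 2 * fps_nth b 0"
    for a b :: "complex fps"
    by (simp add: fps_mult_nth numeral_2_eq_2)
  have "fps_nth (fps_euler f * poly P f) 2 = ?c1 * (p1 + ?c1 * p') + 2 * ?c2 * p"
    by (simp only: nth2 fps_euler_nth P0 P1) simp
  then have eq2: "?c1 * (p1 + ?c1 * p') + 2 * ?c2 * p + (r2 + ?c1 * r1' + ?c2 * r' + ?c1\<^sup>2 * r'' / 2) = 0"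
    using arg_cong[OF f(1), of "\<lambda>x. fps_nth x 2"] by (simp only: sep_residue_def fps_add_nth fps_zero_nth R2)
  have nz': "p + r' \<noteq> 0" "2 * p + r' \<noteq> 0"
    using nz by (auto simp: defs)
  have "?c1 * (p + r') = - r1"
    using eq1 by algebra
  then have c1: "?c1 = - r1 / (p + r')"
    using nz'(1) by (subst nonzero_eq_divide_eq) simp_all
  have "?c2 * (2 * p + r') = - (r2 + ?c1 * (r1' + p1) + ?c1\<^sup>2 * (p' + r'' / 2))"
    using eq2 by (simp add: algebra_simps power2_eq_square eq_neg_iff_add_eq_0)
  then have "?c2 = - (r2 + ?c1 * (r1' + p1) + ?c1\<^sup>2 * (p' + r'' / 2)) / (2 * p + r')"
    using nz'(2) by (subst nonzero_eq_divide_eq) simp_all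
  then show ?thesis
    unfolding sep_coeff_def Let_def defs[symmetric] c1 .
qed

lemma total_degree_add_le:
  fixes A B :: "complex bipoly"
  assumes "total_degree A \<le> N" "total_degree B \<le> N"
  shows "total_degree (A + B) \<le> N"
  using assms unfolding total_degree_le_iff by (metis add.right_neutral coeff_add)

lemma total_degree_partial:
  "total_degree (partial_x G) \<le> total_degree (G :: complex bipoly) - 1"
  "total_degree (partial_y G) \<le> total_degree (G :: complex bipoly) - 1"
proof -
  show "total_degree (partial_x G) \<le> total_degree G - 1"
    unfolding total_degree_le_iff
  proof (intro allI impI)
    fix i j assume "coeff (coeff (partial_x G) j) i \<noteq> 0"
    then have "coeff (coeff G j) (Suc i) \<noteq> 0"
      by (auto simp: partial_x_def coeff_map_poly coeff_pderiv)
    then show "i + j \<le> total_degree G - 1"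
      using total_degree_leD[OF order_refl, of G "Suc i" j] by force
  qed
  show "total_degree (partial_y G) \<le> total_degree G - 1"
    unfolding total_degree_le_iff
  proof (intro allI impI)
    fix i j assume "coeff (coeff (partial_y G) j) i \<noteq> 0"
    then have "coeff (coeff G (Suc j)) i \<noteq> 0"
      by (auto simp: partial_y_def coeff_pderiv of_nat_poly simp flip: of_nat_Suc)
    then show "i + j \<le> total_degree G - 1"
      using total_degree_leD[OF order_refl, of G i "Suc j"] by force
  qed
qed

lemma fps_nth_sum_list: "fps_nth (\<Sum>x\<leftarrow>xs. f x) k = (\<Sum>x\<leftarrow>xs. fps_nth (f x) k)"
  by (induction xs) auto

lemma lead_coeff_pderiv:
  fixes f :: "complex poly"
  shows "lead_coeff (pderiv f) = of_nat (degree f) * lead_coeff f"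
  by (cases "degree f") (auto simp: degree_pderiv coeff_pderiv coeff_eq_0)

text \<open>The list \<open>ts\<close> records the points at infinity of the curve with
  multiplicity. For prime \<open>G\<close> they are distinct: at a repeated factor both
  \<open>G\<close> and its y-derivative would vanish on one separatrix.\<close>

lemma invariant_curve_relation:
  fixes X :: "complex vector_field" and G K :: "complex bipoly" and n d :: nat
  defines "c \<equiv> vf_coeffs X" and "m \<equiv> total_degree G"
  defines "r \<equiv> radial_poly c n" and "p \<equiv> form_poly c False n"
  assumes X: "total_degree (fst X) \<le> n" "total_degree (snd X) \<le> n" and n: "n \<ge> 2"
    and lead: "c (False, 0, n) \<noteq> 0"
    and nonres: "\<And>t e a. poly r t = 0 \<Longrightarrow> 1 \<le> e \<Longrightarrow> 1 \<le> a \<Longrightarrow> a \<le> d \<Longrightarrow>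
       of_nat e * poly p t + of_nat a * poly (pderiv r) t \<noteq> 0"
    and G: "0 < m" "m \<le> d" "fst X * partial_x G + snd X * partial_y G = K * G"
  shows "\<exists>ts. set ts \<subseteq> {t. poly r t = 0} \<and> length ts = m \<and>
     (\<Sum>t\<leftarrow>ts. sep_coeff c n t) = 0 \<and> (prime_elem G \<longrightarrow> distinct ts)"
proof -
  define P where "P = hom_poly n (fst X)"
  define Q where "Q = hom_poly n (snd X)"
  define R where "R = Q - pCons 0 P"
  define Gt where "Gt = hom_poly m G"
  define Kt where "Kt = hom_poly (n - 1) K"
  \<comment> \<open>The term m \<open>Gt\<close> that Euler's identity produces in the x-derivative
    is absorbed into the cofactor.\<close>
  define \<kappa> where "\<kappa> = Kt - of_nat m * P"
  have slice_P: "fps_slice k P = form_poly c False (n - k)" if "k \<le> n" for k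
    using that by (simp add: P_def c_def fps_slice_hom_poly)
  have slice_R: "fps_slice k R = radial_poly c (n - k)" if "k \<le> n" for k
    using that by (simp add: R_def P_def Q_def c_def fps_slice_hom_poly radial_poly_def)
  have p: "fps_slice 0 P = p" and r: "fps_slice 0 R = r"
    using slice_P[of 0] slice_R[of 0] by (auto simp: p_def r_def)
  have "G \<noteq> 0"
    using G(1) by (auto simp: m_def total_degree_def)
  have "total_degree (K * G) \<le> n + (m - 1)"
    unfolding G(3)[symmetric] m_def
    by (intro total_degree_add_le total_degree_mult_le X total_degree_partial)
  then have tdK: "total_degree K \<le> n - 1"
    using total_degree_mult[of K G] \<open>G \<noteq> 0\<close> G(1)
    by (cases "K = 0") (auto simp: m_def total_degree_def)
  have "hom_poly (n + (m - 1)) (fst X * partial_x G + snd X * partial_y G) =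
      P * hom_poly (m - 1) (partial_x G) + Q * hom_poly (m - 1) (partial_y G)"
    using X total_degree_partial[of G] by (simp add: hom_poly_add hom_poly_mult P_def Q_def m_def)
  moreover have "hom_poly (n + (m - 1)) (K * G) = Kt * Gt"
  proof -
    have "n + (m - 1) = (n - 1) + m" using n G(1) by simp
    then show ?thesis
      using hom_poly_mult[OF tdK, of G m] by (simp add: Kt_def Gt_def m_def)
  qed
  moreover have "hom_poly (m - 1) (partial_y G) = pderiv Gt"
    using G(1) by (simp add: Gt_def hom_poly_pderiv)
  moreover have "hom_poly (m - 1) (partial_x G) = of_nat m * Gt - [:0, 1:] * pderiv Gt - map_poly fps_euler Gt"
    using hom_poly_partial_x[OF G(1), of G] by (simp add: Gt_def)
  ultimately have "P * (of_nat m * Gt - [:0, 1:] * pderiv Gt - map_poly fps_euler Gt) + Q * pderiv Gt = Kt * Gt"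
    using G(3) by simp
  moreover have "R = Q - [:0, 1:] * P"
    by (simp add: R_def)
  ultimately have inv: "vf_apply P R Gt = \<kappa> * Gt"
    unfolding vf_apply_def \<kappa>_def by algebra
  define f where "f = fps_slice 0 Gt"
  define k where "k = fps_slice 0 \<kappa>"
  have f0: "f \<noteq> 0"
    unfolding f_def Gt_def m_def by (rule hom_poly_top_nonzero[OF \<open>G \<noteq> 0\<close>])
  have eq: "r * pderiv f = k * f"
    using arg_cong[OF inv, of "fps_slice 0"] by (simp add: fps_slice_vf_apply r f_def k_def)
  have coeff_k: "coeff k j = (if j \<le> n - 1 then coeff (coeff K j) (n - 1 - j) else 0) - of_nat m * coeff p j" for j
    unfolding p[symmetric]
    by (simp add: k_def \<kappa>_def Kt_def hom_poly_nth of_nat_poly flip: fps_of_nat)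
  \<comment> \<open>As K has degree at most n - 1, only -m P contributes to z^n in k. Comparing
    leading coefficients in r f' = k f then gives degree m for f: the curve avoids the point at
    infinity of the y-axis, and \<open>Gt\<close> is a constant times a monic polynomial of degree
    m.\<close>
  have "coeff k n = - of_nat m * c (False, 0, n)"
    using n unfolding coeff_k by (simp add: p_def coeff_form_poly)
  moreover have "degree k = n"
  proof (rule antisym)
    show "degree k \<le> n"
      by (rule degree_le) (auto simp: coeff_k p_def coeff_form_poly)
    show "n \<le> degree k"
      by (rule le_degree) (use calculation lead G(1) in simp)
  qed
  ultimately have lead_k: "lead_coeff k = - of_nat m * c (False, 0, n)"
    by simp
  have lead_r: "lead_coeff r = - c (False, 0, n)"
    using lead by (simp add: r_def lead_coeff_radial_poly)
  have "lead_coeff r * (of_nat (degree f) * lead_coeff f) = lead_coeff k * lead_coeff f"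
    using arg_cong[OF eq, of lead_coeff] unfolding lead_coeff_mult lead_coeff_pderiv .
  then have "(of_nat (degree f) :: complex) = of_nat m"
    unfolding lead_k lead_r using lead f0 by simp
  then have deg_f: "degree f = m"
    by simp
  define b where "b = coeff f m"
  have b: "b \<noteq> 0"
    using f0 unfolding b_def deg_f[symmetric] by simp
  have lead_G: "coeff Gt m = fps_const b"
    by (rule fps_ext) (simp add: b_def f_def Gt_def hom_poly_nth)
  define H where "H = smult (fps_const (inverse b)) Gt"
  have coeff_H_m: "coeff H m = 1"
    using b by (simp add: H_def lead_G)
  have deg_H: "degree H = m"
  proof (rule antisym)
    show "degree H \<le> m"
      by (rule degree_le) (auto simp: H_def Gt_def intro!: fps_ext simp: hom_poly_nth)
    show "m \<le> degree H"
      by (rule le_degree) (simp add: coeff_H_m)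
  qed
  have inv_H: "vf_apply P R H = \<kappa> * H"
    by (simp add: H_def vf_apply_smult_const inv)
  have "\<exists>g. poly r t = 0 \<longrightarrow> fps_nth g 0 = t \<and> sep_residue P R g = 0" for t
    using formal_separatrix_exists[of R t P] nonres[of t _ 1] G(1,2) by (auto simp: p r)
  then obtain \<phi> where \<phi>: "\<And>t. poly r t = 0 \<Longrightarrow> fps_nth (\<phi> t) 0 = t \<and> sep_residue P R (\<phi> t) = 0"
    by metis
  have "r \<noteq> 0" using lead_r lead by auto
  then have "\<exists>ts. set ts \<subseteq> {t. poly r t = 0} \<and> length ts = degree H \<and>
     H = (\<Prod>t\<leftarrow>ts. [:- \<phi> t, 1:]) \<and> coeff (pCons 0 H) (degree H) = - (\<Sum>t\<leftarrow>ts. \<phi> t)"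
    using monic_invariant_factorization[where R = R and \<phi> = \<phi> and d = d and P = P and H = H and \<kappa> = \<kappa>] \<phi> nonres inv_H coeff_H_m G(2)
    unfolding p r deg_H by blast
  then obtain ts where ts: "set ts \<subseteq> {t. poly r t = 0}" "length ts = m"
      "H = (\<Prod>t\<leftarrow>ts. [:- \<phi> t, 1:])" "coeff (pCons 0 H) m = - (\<Sum>t\<leftarrow>ts. \<phi> t)"
    unfolding deg_H by blast
  have "fps_nth (coeff (pCons 0 H) m) 2 = 0"
    using G(1) by (cases m) (auto simp: H_def Gt_def hom_poly_nth)
  then have "(\<Sum>t\<leftarrow>ts. fps_nth (\<phi> t) 2) = 0"
    unfolding ts(4) by (simp add: fps_nth_sum_list)
  moreover have "fps_nth (\<phi> t) 2 = sep_coeff c n t" if "t \<in> set ts" for t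
  proof (rule sep_coeff_eq_nth[of P R, OF _ _ slice_P slice_R n])
    have t: "poly r t = 0" using that ts(1) by auto
    show "sep_residue P R (\<phi> t) = 0" "fps_nth (\<phi> t) 0 = t"
      using \<phi>[OF t] by auto
    show "poly (form_poly c False n) t + poly (pderiv (radial_poly c n)) t \<noteq> 0"
      using nonres[OF t, of 1 1] G(1,2) by (simp add: p_def r_def)
    show "2 * poly (form_poly c False n) t + poly (pderiv (radial_poly c n)) t \<noteq> 0"
      using nonres[OF t, of 2 1] G(1,2) by (simp add: p_def r_def)
  qed
  ultimately have "(\<Sum>t\<leftarrow>ts. sep_coeff c n t) = 0"
    by (simp cong: map_cong)
  moreover have "distinct ts" if prime: "prime_elem G"
  proof (rule ccontr)
    assume "\<not> distinct ts"
    then obtain xs ys zs t where "ts = xs @ [t] @ ys @ [t] @ zs"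
      using not_distinct_decomp by blast
    then have "\<exists>A. H = [:- \<phi> t, 1:] * ([:- \<phi> t, 1:] * A)"
      unfolding ts(3) by (intro exI[of _ "(\<Prod>t\<leftarrow>xs @ ys @ zs. [:- \<phi> t, 1:])"]) (simp add: mult_ac del: mult_pCons_left mult_pCons_right)
    then obtain A where A: "H = [:- \<phi> t, 1:] * ([:- \<phi> t, 1:] * A)" ..
    have "poly H (\<phi> t) = 0" "poly (pderiv H) (\<phi> t) = 0"
      unfolding A pderiv_mult by (simp_all add: pderiv_pCons)
    then have zero: "poly Gt (\<phi> t) = 0" "poly (pderiv Gt) (\<phi> t) = 0"
      using b by (simp_all add: H_def pderiv_smult)
    \<comment> \<open>This is the coefficient of y^m, so that G has positive degree in y, as the
      pseudo-division argument requires.\<close>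
    have "coeff (coeff G m) 0 \<noteq> 0"
      using b by (simp add: b_def f_def Gt_def hom_poly_nth)
    then have "coeff G m \<noteq> 0" by auto
    then have "degree G > 0"
      using le_degree[of G m] G(1) by simp
    moreover have "poly (hom_poly (m - 1) (pderiv G)) (\<phi> t) = 0"
      using zero(2) G(1) by (simp add: Gt_def hom_poly_pderiv partial_y_def)
    moreover have "total_degree (pderiv G) \<le> m - 1"
      using total_degree_partial(2)[of G] by (simp add: m_def partial_y_def)
    ultimately show False
      using prime_elem_simple_separatrix[OF prime, of m "\<phi> t" "m - 1"] zero(1) by (simp add: Gt_def m_def)
  qed
  ultimately show ?thesis
    using ts by blast
qed

section \<open>Reduction to irreducible curves\<close>

definition vf_derivation :: "complex vector_field \<Rightarrow> complex bipoly \<Rightarrow> complex bipoly" where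
  "vf_derivation X G = fst X * partial_x G + snd X * partial_y G"

lemma vf_derivation_mult:
  "vf_derivation X (A * B) = vf_derivation X A * B + A * vf_derivation X B"
proof -
  have sum: "pderiv (sum f S) = (\<Sum>s\<in>S. pderiv (f s))" for f :: "nat \<Rightarrow> complex poly" and S
    by (induction S rule: infinite_finite_induct) (auto simp: pderiv_add)
  have "partial_x (A * B) = partial_x A * B + A * partial_x B"
    unfolding partial_x_def
    by (rule poly_eqI)
      (simp only: coeff_map_poly pderiv_0 coeff_add coeff_mult sum pderiv_mult sum.distrib,
        simp only: add.commute mult.commute)
  then show ?thesis
    by (simp add: vf_derivation_def partial_y_def pderiv_mult algebra_simps)
qed

lemma vf_derivation_power:
  "vf_derivation X (A ^ Suc e) = of_nat (Suc e) * A ^ e * vf_derivation X A"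
  by (induction e) (simp_all add: vf_derivation_mult algebra_simps)

text \<open>Write G = H^(e+1) y with H prime and not dividing y. Dividing the invariance equation by
  H^e shows that H divides (e+1) L(H) y; here e + 1 is a unit in characteristic 0, so H divides
  L(H).\<close>

lemma invariant_prime_factor:
  assumes "invariant_algebraic_curve X G"
  shows "\<exists>H. prime_elem H \<and> invariant_algebraic_curve X H"
proof -
  obtain K where G: "total_degree G > 0" and K: "vf_derivation X G = K * G"
    using assms by (auto simp: invariant_algebraic_curve_def vf_derivation_def)
  have "G \<noteq> 0" using G by (auto simp: total_degree_def)
  have "\<not> is_unit G"
  proof
    assume "is_unit G"
    then obtain g where "G = [:[:g:]:]"
      by (metis is_unit_poly_iff)
    then have "total_degree G \<le> 0"
      unfolding total_degree_le_iff by (auto simp: coeff_pCons split: nat.splits)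
    then show False
      using G by simp
  qed
  then obtain H where H: "prime H" "H dvd G"
    using \<open>G \<noteq> 0\<close> by (auto elim: prime_divisorE)
  then have pH: "prime_elem H" "\<not> is_unit H" "H \<noteq> 0"
    by (auto simp: prime_def)
  obtain y where y: "G = H ^ multiplicity H G * y" "\<not> H dvd y"
    using multiplicity_decompose'[OF \<open>G \<noteq> 0\<close> pH(2)] by blast
  then have "multiplicity H G \<noteq> 0"
    using H(2) by (metis mult_1 power_0)
  then obtain e where e: "multiplicity H G = Suc e"
    using not0_implies_Suc by blast
  define L where "L = vf_derivation X"
  have "of_nat (Suc e) * H ^ e * L H * y + H ^ Suc e * L y = K * (H ^ Suc e * y)"
    using K unfolding L_def vf_derivation_power[symmetric] vf_derivation_mult[symmetric]
    using y(1) unfolding e by metis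
  then have "H ^ e * (of_nat (Suc e) * L H * y) = H ^ e * (H * (K * y - L y))"
    unfolding power_Suc by (simp only: right_diff_distrib eq_diff_eq mult_ac)
  then have "of_nat (Suc e) * L H * y = H * (K * y - L y)"
    using pH(3) by simp
  then have "H dvd of_nat (Suc e) * L H * y" by simp
  then have "H dvd of_nat (Suc e) * L H"
    using y(2) pH(1) by (simp add: prime_elem_dvd_mult_iff)
  moreover have "is_unit (of_nat (Suc e) :: complex bipoly)"
    by (rule dvdI[of _ _ "[:[:inverse (of_nat (Suc e)):]:]"])
      (simp add: of_nat_poly one_pCons del: of_nat_Suc)
  ultimately have "H dvd L H"
    by (metis dvd_mult_unit_iff mult.commute)
  then obtain K' where "L H = K' * H"
    by (metis dvdE mult.commute)
  moreover have "total_degree H > 0"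
  proof (rule ccontr)
    assume "\<not> total_degree H > 0"
    then have "total_degree H \<le> 0" by simp
    then have "H = [:[:coeff (coeff H 0) 0:]:]"
      using total_degree_leD[of H 0]
      by (auto intro!: poly_eqI simp: coeff_pCons split: nat.splits)
    then obtain h where h: "H = [:[:h:]:]" by blast
    then have "H * [:[:inverse h:]:] = 1"
      using pH(3) by (simp add: one_pCons)
    then show False
      using pH(2) by (metis dvd_triv_left)
  qed
  ultimately show ?thesis
    using pH(1) by (auto simp: invariant_algebraic_curve_def vf_derivation_def L_def)
qed

subsection \<open>Null sets and curves of parameters\<close>

lemma PiM_lborel_translate:
  fixes v :: "'i \<Rightarrow> 'a::euclidean_space"
  assumes "finite I"
  shows "distr (PiM I (\<lambda>_. lborel)) (PiM I (\<lambda>_. lborel)) (\<lambda>x. \<lambda>i\<in>I. x i + v i) = PiM I (\<lambda>_. lborel)"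
    (is "distr ?M ?M ?f = ?M")
proof -
  interpret product_sigma_finite "\<lambda>_::'i. lborel :: 'a measure"
    by standard
  have meas: "?f \<in> measurable ?M ?M"
    by (intro measurable_restrict) simp
  show ?thesis
  proof (rule PiM_eqI[OF assms])
    fix A :: "'i \<Rightarrow> 'a set"
    assume A: "\<And>i. i \<in> I \<Longrightarrow> A i \<in> sets lborel"
    have shift: "(\<lambda>y. y + v i) -` A i \<in> sets lborel" "emeasure lborel ((\<lambda>y. y + v i) -` A i) = emeasure lborel (A i)"
      if "i \<in> I" for i
    proof -
      have "(\<lambda>y. y + v i) \<in> measurable lborel lborel" by simp
      from measurable_sets[OF this A[OF that]]
      show "(\<lambda>y. y + v i) -` A i \<in> sets lborel" by simp
      have "emeasure lborel (A i) = emeasure (distr lborel borel ((+) (v i))) (A i)"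
        by (simp only: lborel_distr_plus)
      also have "\<dots> = emeasure lborel ((+) (v i) -` A i)"
        using A[OF that] by (subst emeasure_distr) auto
      also have "(+) (v i) -` A i = (\<lambda>y. y + v i) -` A i"
        by (simp add: vimage_def add.commute)
      finally show "emeasure lborel ((\<lambda>y. y + v i) -` A i) = emeasure lborel (A i)" ..
    qed
    have "Pi\<^sub>E I A \<in> sets ?M"
      using A assms by (intro sets_PiM_I_finite) auto
    then have "emeasure (distr ?M ?M ?f) (Pi\<^sub>E I A) = emeasure ?M (?f -` Pi\<^sub>E I A \<inter> space ?M)"
      using meas by (subst emeasure_distr) auto
    also have "?f -` Pi\<^sub>E I A \<inter> space ?M = Pi\<^sub>E I (\<lambda>i. (\<lambda>y. y + v i) -` A i)"
      by (auto simp: space_PiM PiE_iff)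
    also have "emeasure ?M \<dots> = (\<Prod>i\<in>I. emeasure lborel (A i))"
      using assms shift by (subst emeasure_PiM) auto
    finally show "emeasure (distr ?M ?M ?f) (Pi\<^sub>E I A) = (\<Prod>i\<in>I. emeasure lborel (A i))" .
  qed simp
qed

text \<open>Tonelli, followed by translation invariance on almost every slice.\<close>
lemma AE_along_curves:
  fixes \<tau> :: "'b::euclidean_space \<Rightarrow> 'i \<Rightarrow> 'a::euclidean_space"
  assumes I: "finite I" and N: "N \<in> sets (PiM I (\<lambda>_. lborel))"
    and \<tau>: "\<And>i. i \<in> I \<Longrightarrow> (\<lambda>s. \<tau> s i) \<in> borel_measurable borel"
    and AE: "AE x in PiM I (\<lambda>_. lborel). AE s in lborel. (\<lambda>i\<in>I. x i + \<tau> s i) \<notin> N"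
  shows "AE x in PiM I (\<lambda>_. lborel). x \<notin> N"
proof -
  let ?M = "PiM I (\<lambda>_. lborel :: 'a measure)"
  interpret product_sigma_finite "\<lambda>_::'i. lborel :: 'a measure"
    by standard
  interpret M: sigma_finite_measure ?M
    by (rule sigma_finite[OF I])
  interpret pair_sigma_finite ?M "lborel :: 'b measure"
    by standard
  have meas: "(\<lambda>z. \<lambda>i\<in>I. fst z i + \<tau> (snd z) i) \<in> measurable (?M \<Otimes>\<^sub>M lborel) ?M" (is "?F \<in> _")
  proof (rule measurable_restrict)
    fix i assume i: "i \<in> I"
    have "(\<lambda>z. fst z i) \<in> measurable (?M \<Otimes>\<^sub>M (lborel :: 'b measure)) lborel"
      using measurable_compose[OF measurable_fst[of ?M lborel] measurable_component_singleton[OF i, of "\<lambda>_. lborel"]]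
      by simp
    moreover have "(\<lambda>z. \<tau> (snd z) i) \<in> measurable (?M \<Otimes>\<^sub>M (lborel :: 'b measure)) lborel"
      using measurable_compose[OF measurable_snd, of "\<lambda>s. \<tau> s i" "lborel :: 'b measure" borel ?M] \<tau>[OF i] by simp
    ultimately show "(\<lambda>z. fst z i + \<tau> (snd z) i) \<in> measurable (?M \<Otimes>\<^sub>M lborel) lborel"
      by simp
  qed
  have "{z \<in> space (?M \<Otimes>\<^sub>M lborel). ?F z \<notin> N} = ?F -` (space ?M - N) \<inter> space (?M \<Otimes>\<^sub>M lborel)"
    using measurable_space[OF meas] by blast
  then have "{z \<in> space (?M \<Otimes>\<^sub>M lborel). ?F z \<notin> N} \<in> sets (?M \<Otimes>\<^sub>M lborel)"
    using measurable_sets[OF meas, of "space ?M - N"] N by (simp only: sets.compl_sets)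
  from iffD1[OF AE_commute[OF this] AE]
  have "AE s in lborel. AE x in ?M. (\<lambda>i\<in>I. x i + \<tau> s i) \<notin> N" .
  \<comment> \<open>One good s is enough, and it exists because Lebesgue measure is not zero;
    translation by \<tau>(s) then carries the statement back to x.\<close>
  then obtain s where s: "AE x in ?M. (\<lambda>i\<in>I. x i + \<tau> s i) \<notin> N"
    using eventually_happens'[of "ae_filter (lborel :: 'b measure)"] by (auto simp: ae_filter_eq_bot_iff)
  have meas: "(\<lambda>x. \<lambda>i\<in>I. x i + \<tau> s i) \<in> measurable ?M ?M"
    by (intro measurable_restrict) simp
  have "AE x in distr ?M ?M (\<lambda>x. \<lambda>i\<in>I. x i + \<tau> s i). x \<notin> N"
    using s N by (subst AE_distr_iff[OF meas]) auto
  then show ?thesis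
    unfolding PiM_lborel_translate[OF I] .
qed

text \<open>The generic conditions are open sets of functions on the whole index type, while the
  measure lives on functions that are \<open>undefined\<close> outside I. The inclusion is
  measurable, and for countably many indices the Borel sets are those of the product.\<close>

lemma sets_PiM_lborel_open:
  fixes U :: "('i::countable \<Rightarrow> 'a::euclidean_space) set"
  assumes "open U"
  shows "U \<inter> space (PiM I (\<lambda>_. lborel)) \<in> sets (PiM I (\<lambda>_. lborel))"
proof -
  let ?M = "PiM I (\<lambda>_. lborel :: 'a measure)"
  have "(\<lambda>x. x) \<in> measurable ?M (PiM UNIV (\<lambda>_. borel))"
  proof (rule measurable_PiM_single')
    fix i :: 'i
    show "(\<lambda>x. x i) \<in> measurable ?M borel"
    proof (cases "i \<in> I")
      case True
      then show ?thesis using measurable_component_singleton[of i I "\<lambda>_. lborel"] by simp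
    next
      case False
      then have "x i = undefined" if "x \<in> space ?M" for x
        using that by (auto simp: space_PiM PiE_iff extensional_def)
      then show ?thesis
        by (subst measurable_cong[of _ _ "\<lambda>_. undefined"]) auto
    qed
  qed (auto simp: space_PiM PiE_iff)
  moreover have "U \<in> sets (PiM UNIV (\<lambda>_. borel))"
    using assms by (simp add: sets_PiM_equal_borel)
  ultimately have "(\<lambda>x. x) -` U \<inter> space ?M \<in> sets ?M"
    by (rule measurable_sets)
  then show ?thesis by simp
qed

text \<open>The topological counterpart: openness needs proof only in the topology of all functions,
  since coordinates outside I are constant and the inclusion is continuous.\<close>

lemma openin_product_topology_open:
  fixes U :: "('i \<Rightarrow> 'a::topological_space) set"
  assumes "open U"
  shows "openin (product_topology (\<lambda>_. euclidean) I) (U \<inter> extensional I)"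
proof -
  let ?T = "product_topology (\<lambda>_. euclidean :: 'a topology) I"
  have "continuous_map ?T (product_topology (\<lambda>_. euclidean) UNIV) (\<lambda>x. x)"
    unfolding continuous_map_componentwise_UNIV
  proof
    fix i
    show "continuous_map ?T euclidean (\<lambda>x. x i)"
    proof (cases "i \<in> I")
      case True
      then show ?thesis by (rule continuous_map_product_projection)
    next
      case False
      have "continuous_map ?T euclidean (\<lambda>_. undefined :: 'a)" by simp
      then show ?thesis
        by (rule continuous_map_eq) (use False in \<open>auto simp: PiE_iff extensional_def\<close>)
    qed
  qed
  then have "openin ?T {x \<in> topspace ?T. x \<in> U}"
    using assms unfolding euclidean_product_topology by (intro openin_continuous_map_preimage) auto
  moreover have "{x \<in> topspace ?T. x \<in> U} = U \<inter> extensional I"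
    by (auto simp: PiE_iff)
  ultimately show ?thesis by simp
qed

text \<open>Turns full measure into density: an open set around x contains an open box, whose
  measure is a finite product of positive numbers.\<close>

lemma PiM_lborel_open_positive:
  fixes I :: "'i set"
  assumes I: "finite I" and W: "openin (product_topology (\<lambda>_. euclidean) I) W" "x \<in> W"
    and AE: "AE y in PiM I (\<lambda>_. lborel :: 'a::euclidean_space measure). Q y"
  shows "\<exists>y\<in>W. Q y"
proof -
  let ?M = "PiM I (\<lambda>_. lborel :: 'a measure)"
  interpret product_sigma_finite "\<lambda>_::'i. lborel :: 'a measure"
    by standard
  obtain U where U: "finite {i \<in> I. U i \<noteq> UNIV}" "\<And>i. i \<in> I \<Longrightarrow> open (U i)" "x \<in> Pi\<^sub>E I U" "Pi\<^sub>E I U \<subseteq> W"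
    using W unfolding openin_product_topology_alt by (force simp: topspace_euclidean)
  have sets: "Pi\<^sub>E I U \<in> sets ?M"
    using U I by (intro sets_PiM_I_finite) auto
  have "emeasure ?M (Pi\<^sub>E I U) = (\<Prod>i\<in>I. emeasure lborel (U i))"
    using U I by (intro emeasure_PiM) auto
  also have "\<dots> \<noteq> 0"
  proof -
    have "emeasure lborel (U i) \<noteq> 0" if "i \<in> I" for i
    proof
      assume "emeasure lborel (U i) = 0"
      then have "negligible (U i)"
        using U(2)[OF that] by (auto simp: negligible_iff_null_sets null_sets_def)
      moreover have "U i \<noteq> {}" using U(3) that by auto
      ultimately show False
        using open_not_negligible[OF U(2)[OF that]] by blast
    qed
    then show ?thesis using I by simp
  qed
  finally have pos: "emeasure ?M (Pi\<^sub>E I U) \<noteq> 0" .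
  show ?thesis
  proof (rule ccontr)
    assume "\<not> (\<exists>y\<in>W. Q y)"
    then have "AE y in ?M. y \<notin> Pi\<^sub>E I U"
      using AE U(4) by (auto elim!: eventually_mono)
    then have "Pi\<^sub>E I U \<in> null_sets ?M"
      using sets by (subst AE_iff_null_sets) auto
    with pos show False by auto
  qed
qed

subsection \<open>Openness of the generic conditions\<close>

text \<open>The quotient is minus the ratio of eigenvalues at the singular point t of the line at infinity.\<close>
definition generic_at_infinity :: "complex set \<Rightarrow> nat \<Rightarrow> nat \<Rightarrow> (bool \<times> nat \<times> nat \<Rightarrow> complex) \<Rightarrow> bool" where
  "generic_at_infinity E d n c \<longleftrightarrow> c (False, 0, n) \<noteq> 0 \<and>
     (\<forall>t. poly (radial_poly c n) t = 0 \<longrightarrow> poly (pderiv (radial_poly c n)) t \<noteq> 0 \<and>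
        poly (form_poly c False n) t / poly (pderiv (radial_poly c n)) t \<notin> E) \<and>
     (\<forall>ts. set ts \<subseteq> {t. poly (radial_poly c n) t = 0} \<longrightarrow> 1 \<le> length ts \<longrightarrow> length ts \<le> d \<longrightarrow>
        (\<Sum>t\<leftarrow>ts. sep_coeff c n t) \<noteq> 0)"

lemma poly_eq_sum_le:
  fixes q :: "'a::comm_ring_1 poly"
  assumes "degree q \<le> D"
  shows "poly q z = (\<Sum>i\<le>D. coeff q i * z ^ i)"
  unfolding poly_altdef by (rule sum.mono_neutral_left) (use assms in \<open>auto simp: coeff_eq_0\<close>)

lemma continuous_on_coeff_form_poly: "continuous_on UNIV (\<lambda>c. coeff (form_poly c b N) j)"
  by (cases "j \<le> N") (auto simp: coeff_form_poly)

lemma continuous_on_coeff_radial_poly: "continuous_on UNIV (\<lambda>c. coeff (radial_poly c N) j)"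
  unfolding radial_poly_def coeff_diff
  by (cases j) (auto intro!: continuous_intros continuous_on_coeff_form_poly)

text \<open>The uniform degree bound makes evaluation a fixed finite sum of continuous
  functions.\<close>

definition cont_poly :: "('x::topological_space \<Rightarrow> complex poly) \<Rightarrow> bool" where
  "cont_poly q \<longleftrightarrow> (\<exists>D. \<forall>x. degree (q x) \<le> D) \<and> (\<forall>i. continuous_on UNIV (\<lambda>x. coeff (q x) i))"

lemma cont_poly_eval:
  assumes "cont_poly q" "continuous_on UNIV g"
  shows "continuous_on UNIV (\<lambda>x. poly (q x) (g x))"
proof -
  obtain D where D: "\<And>x. degree (q x) \<le> D"
    using assms(1) by (auto simp: cont_poly_def)
  have "poly (q x) (g x) = (\<Sum>i\<le>D. coeff (q x) i * g x ^ i)" for x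
    using D[of x] by (rule poly_eq_sum_le)
  moreover have "continuous_on UNIV (\<lambda>x. \<Sum>i\<le>D. coeff (q x) i * g x ^ i)"
    using assms by (intro continuous_intros) (auto simp: cont_poly_def)
  ultimately show ?thesis by simp
qed

lemma cont_poly_pderiv:
  assumes "cont_poly q"
  shows "cont_poly (\<lambda>x. pderiv (q x))"
proof -
  obtain D where "\<And>x. degree (q x) \<le> D"
    using assms by (auto simp: cont_poly_def)
  then have "\<And>x. degree (pderiv (q x)) \<le> D"
    by (metis degree_pderiv diff_le_self le_trans)
  moreover have "continuous_on UNIV (\<lambda>x. coeff (pderiv (q x)) i)" for i
    unfolding coeff_pderiv using assms by (intro continuous_intros) (auto simp: cont_poly_def)
  ultimately show ?thesis
    unfolding cont_poly_def by blast
qed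

lemma cont_poly_form_poly: "cont_poly (\<lambda>x. form_poly (fst x) b N)"
proof -
  have "degree (form_poly c b N) \<le> N" for c
    by (rule degree_le) (simp add: coeff_form_poly)
  then show ?thesis
    unfolding cont_poly_def
    using continuous_on_compose2[OF continuous_on_coeff_form_poly continuous_on_fst[OF continuous_on_id]]
    by blast
qed

lemma cont_poly_radial_poly: "cont_poly (\<lambda>x. radial_poly (fst x) N)"
  unfolding cont_poly_def
  using continuous_on_compose2[OF continuous_on_coeff_radial_poly continuous_on_fst[OF continuous_on_id]]
    degree_radial_poly_le
  by blast

text \<open>Cauchy's root bound, in a form whose constants serve a whole neighbourhood of a
  polynomial.\<close>

lemma root_norm_bound:
  fixes q :: "complex poly"
  assumes "poly q z = 0" "degree q \<le> Suc n" "norm (coeff q (Suc n)) > \<delta>" "\<delta> > 0"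
    and "\<And>i. i \<le> n \<Longrightarrow> norm (coeff q i) \<le> B"
  shows "norm z \<le> max 1 (of_nat (Suc n) * B / \<delta>)"
proof (cases "norm z \<le> 1")
  case False
  have "0 = (\<Sum>i\<le>Suc n. coeff q i * z ^ i)"
    using assms(1) poly_eq_sum_le[OF assms(2), of z] by simp
  then have "coeff q (Suc n) * z ^ Suc n = - (\<Sum>i\<le>n. coeff q i * z ^ i)"
    by (simp add: eq_neg_iff_add_eq_0 add.commute)
  then have "norm (coeff q (Suc n)) * norm z ^ Suc n = norm (\<Sum>i\<le>n. coeff q i * z ^ i)"
    by (metis norm_minus_cancel norm_mult norm_power)
  also have "\<dots> \<le> (\<Sum>i\<le>n. B * norm z ^ n)"
  proof (intro sum_norm_le)
    fix i assume "i \<in> {..n}"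
    then show "norm (coeff q i * z ^ i) \<le> B * norm z ^ n"
      unfolding norm_mult norm_power
      using assms(5)[of i] False
      by (intro mult_mono power_increasing) (auto intro: order_trans[OF norm_ge_zero])
  qed
  also have "\<dots> = (of_nat (Suc n) * B) * norm z ^ n"
    by simp
  finally have "(norm (coeff q (Suc n)) * norm z) * norm z ^ n \<le> (of_nat (Suc n) * B) * norm z ^ n"
    by (simp add: mult.assoc)
  moreover have "norm z ^ n > 0"
    using False by (intro zero_less_power) linarith
  ultimately have "norm (coeff q (Suc n)) * norm z \<le> of_nat (Suc n) * B"
    by (rule mult_right_le_imp_le)
  moreover have "\<delta> * norm z \<le> norm (coeff q (Suc n)) * norm z"
    using assms(3) by (intro mult_right_mono) auto
  ultimately have "norm z \<le> of_nat (Suc n) * B / \<delta>"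
    using assms(4) by (simp add: field_simps)
  then show ?thesis by simp
qed simp

lemma compact_function_ball: "compact {v :: nat \<Rightarrow> complex. \<forall>i. norm (v i) \<le> R}"
proof -
  have "compactin (product_topology (\<lambda>_. euclidean) UNIV) (PiE UNIV (\<lambda>_::nat. cball (0::complex) R))"
    unfolding compactin_PiE by auto
  moreover have "PiE UNIV (\<lambda>_::nat. cball (0::complex) R) = {v. \<forall>i. norm (v i) \<le> R}"
    by (auto simp: PiE_iff)
  ultimately show ?thesis
    by (simp add: euclidean_product_topology)
qed

text \<open>The same conditions for a field together with an enumeration of its points at infinity, which makes
  them visibly open; compactness of the set of enumerations removes it again.\<close>
definition generic_tuple :: "complex set \<Rightarrow> nat \<Rightarrow> nat \<Rightarrow> ((bool \<times> nat \<times> nat \<Rightarrow> complex) \<times> (nat \<Rightarrow> complex)) set" where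
  "generic_tuple E d n = {x. fst x (False, 0, n) \<noteq> 0 \<and>
     (\<forall>i\<in>{..n}. poly (pderiv (radial_poly (fst x) n)) (snd x i) \<noteq> 0 \<and>
        poly (form_poly (fst x) False n) (snd x i) / poly (pderiv (radial_poly (fst x) n)) (snd x i) \<notin> E) \<and>
     (\<forall>js\<in>{js. set js \<subseteq> {..n} \<and> length js \<le> d} - {[]}. (\<Sum>j\<leftarrow>js. sep_coeff (fst x) n (snd x j)) \<noteq> 0)}"

text \<open>The values -1 and -1/2 of p/r' are those at which the denominators p + r' and 2 p + r'
  of \<open>sep_coeff\<close> vanish. They matter only for d \<ge> 1, when there are sums to
  consider.\<close>

lemma open_generic_tuple:
  assumes E: "closed E" and res: "d \<ge> 1 \<Longrightarrow> -1 \<in> E \<and> -1/2 \<in> E"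
  shows "open (generic_tuple E d n)"
proof -
  let ?p = "\<lambda>x (i::nat). poly (form_poly (fst x) False n) (snd x i)"
  let ?r' = "\<lambda>x (i::nat). poly (pderiv (radial_poly (fst x) n)) (snd x i)"
  let ?X = "UNIV :: ((bool \<times> nat \<times> nat \<Rightarrow> complex) \<times> (nat \<Rightarrow> complex)) set"
  have snd: "continuous_on ?X (\<lambda>x. snd x i)" for i
    by (rule continuous_on_product_then_coordinatewise[OF continuous_on_snd[OF continuous_on_id]])
  have fst: "continuous_on ?X (\<lambda>x. fst x i)" for i
    by (rule continuous_on_product_then_coordinatewise[OF continuous_on_fst[OF continuous_on_id]])
  note conts = cont_poly_eval[OF cont_poly_form_poly snd] cont_poly_eval[OF cont_poly_radial_poly snd]
    cont_poly_eval[OF cont_poly_pderiv[OF cont_poly_form_poly] snd]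
    cont_poly_eval[OF cont_poly_pderiv[OF cont_poly_radial_poly] snd]
    cont_poly_eval[OF cont_poly_pderiv[OF cont_poly_pderiv[OF cont_poly_radial_poly]] snd]
  note conts_on = conts[THEN continuous_on_subset, OF subset_UNIV]
  \<comment> \<open>On the open set \<open>V\<close> all quotients exist and are continuous, so that
    sets open relative to \<open>V\<close> are open.\<close>
  define V where "V = {x \<in> ?X. fst x (False, 0, n) \<noteq> 0} \<inter> (\<Inter>i\<in>{..n}. {x. ?r' x i \<noteq> 0 \<and> ?p x i / ?r' x i \<notin> E})"
  have "open {x. ?r' x i \<noteq> 0 \<and> ?p x i / ?r' x i \<notin> E}" for i
  proof -
    have op: "open {x. ?r' x i \<noteq> 0}"
      by (intro open_Collect_neq conts continuous_intros)
    have "continuous_on {x. ?r' x i \<noteq> 0} (\<lambda>x. ?p x i / ?r' x i)"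
      by (intro continuous_on_divide conts_on) auto
    from iffD1[OF continuous_on_open_vimage[OF op] this, rule_format, of "- E"] E
    have "open ((\<lambda>x. ?p x i / ?r' x i) -` (- E) \<inter> {x. ?r' x i \<noteq> 0})"
      by (simp add: open_Compl)
    then show ?thesis
      by (rule back_subst[where P = "open"]) auto
  qed
  then have V: "open V"
    unfolding V_def by (intro open_Int open_INT ballI finite_atMost) (auto intro!: open_Collect_neq fst continuous_intros)
  have denom: "?p x i + ?r' x i \<noteq> 0" "2 * ?p x i + ?r' x i \<noteq> 0" if "x \<in> V" "i \<le> n" "d \<ge> 1" for x i
  proof -
    have r': "?r' x i \<noteq> 0" "?p x i / ?r' x i \<notin> E"
      using that by (auto simp: V_def)
    then show "?p x i + ?r' x i \<noteq> 0"
      using res[OF that(3)] by (auto simp: add_eq_0_iff2)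
    show "2 * ?p x i + ?r' x i \<noteq> 0"
    proof
      assume "2 * ?p x i + ?r' x i = 0"
      then have "?p x i / ?r' x i = -1/2"
        using r'(1) by (simp add: field_simps add_eq_0_iff2)
      then show False using r'(2) res[OF that(3)] by simp
    qed
  qed
  have cont: "continuous_on V (\<lambda>x. sep_coeff (fst x) n (snd x i))" if "i \<le> n" "d \<ge> 1" for i
    unfolding sep_coeff_def Let_def
    by (intro continuous_intros conts_on)
      (use denom that in auto)
  have "continuous_on V (\<lambda>x. \<Sum>j\<leftarrow>js. sep_coeff (fst x) n (snd x j))" if "set js \<subseteq> {..n}" "d \<ge> 1" for js
    using that(1) by (induction js) (auto intro!: continuous_intros cont that(2))
  then have "open (V \<inter> {x. (\<Sum>j\<leftarrow>js. sep_coeff (fst x) n (snd x j)) \<noteq> 0})"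
    if "js \<in> {js. set js \<subseteq> {..n} \<and> length js \<le> d} - {[]}" for js
  proof -
    have "d \<ge> 1" using that by (cases js) auto
    then have "continuous_on V (\<lambda>x. \<Sum>j\<leftarrow>js. sep_coeff (fst x) n (snd x j))"
      using that \<open>\<And>js. set js \<subseteq> {..n} \<Longrightarrow> d \<ge> 1 \<Longrightarrow> continuous_on V (\<lambda>x. \<Sum>j\<leftarrow>js. sep_coeff (fst x) n (snd x j))\<close>
      by auto
    from iffD1[OF continuous_on_open_vimage[OF V] this, rule_format, of "- {0}"]
    show ?thesis
      by (simp add: open_Compl vimage_def Int_def conj_commute)
  qed
  moreover have "finite ({js. set js \<subseteq> {..n} \<and> length js \<le> d} - {[]})"
    by (intro finite_Diff finite_lists_length_le finite_atMost)
  ultimately have "open (V \<inter> (\<Inter>js\<in>{js. set js \<subseteq> {..n} \<and> length js \<le> d} - {[]}.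
      V \<inter> {x. (\<Sum>j\<leftarrow>js. sep_coeff (fst x) n (snd x j)) \<noteq> 0}))"
    using V by (intro open_Int open_INT) auto
  also have "V \<inter> (\<Inter>js\<in>{js. set js \<subseteq> {..n} \<and> length js \<le> d} - {[]}.
      V \<inter> {x. (\<Sum>j\<leftarrow>js. sep_coeff (fst x) n (snd x j)) \<noteq> 0}) = generic_tuple E d n"
    by (auto simp: V_def generic_tuple_def)
  finally show ?thesis .
qed

lemma generic_at_infinity_iff_tuple:
  assumes lead: "c (False, 0, n) \<noteq> 0"
    and fact: "radial_poly c n = smult (- c (False, 0, n)) (\<Prod>i\<le>n. [:- v i, 1:])"
  shows "generic_at_infinity E d n c \<longleftrightarrow> (c, v) \<in> generic_tuple E d n"
proof -
  have roots: "{t. poly (radial_poly c n) t = 0} = v ` {..n}"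
    unfolding fact using lead by (auto simp: poly_prod)
  have lists: "(\<forall>ts. set ts \<subseteq> v ` {..n} \<longrightarrow> 1 \<le> length ts \<longrightarrow> length ts \<le> d \<longrightarrow> (\<Sum>t\<leftarrow>ts. sep_coeff c n t) \<noteq> 0) \<longleftrightarrow>
      (\<forall>js\<in>{js. set js \<subseteq> {..n} \<and> length js \<le> d} - {[]}. (\<Sum>j\<leftarrow>js. sep_coeff c n (v j)) \<noteq> 0)" (is "?l \<longleftrightarrow> ?r")
  proof
    assume ?l
    show ?r
    proof
      fix js assume "js \<in> {js. set js \<subseteq> {..n} \<and> length js \<le> d} - {[]}"
      then show "(\<Sum>j\<leftarrow>js. sep_coeff c n (v j)) \<noteq> 0"
        using \<open>?l\<close>[rule_format, of "map v js"] by (auto simp: o_def Suc_le_eq)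
    qed
  next
    assume ?r
    show ?l
    proof (intro allI impI)
      fix ts assume ts: "set ts \<subseteq> v ` {..n}" "1 \<le> length ts" "length ts \<le> d"
      then have "ts \<in> lists (v ` {..n})" by auto
      then obtain js where "ts = map v js" "set js \<subseteq> {..n}"
        unfolding lists_image by (auto simp: lists_eq_set)
      moreover from this have "js \<noteq> []" using ts(2) by auto
      ultimately show "(\<Sum>t\<leftarrow>ts. sep_coeff c n t) \<noteq> 0"
        using \<open>?r\<close>[rule_format, of js] ts by (auto simp: o_def)
    qed
  qed
  have "(\<forall>t. poly (radial_poly c n) t = 0 \<longrightarrow> Q t) \<longleftrightarrow> (\<forall>i\<in>{..n}. Q (v i))" for Q
    using roots by (auto simp: set_eq_iff image_iff)
  then show ?thesis
    unfolding generic_at_infinity_def generic_tuple_def roots lists by simp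
qed

text \<open>Roots have no continuous labelling, so all enumerations are treated at once: near
  \<open>c0\<close> every enumeration of the roots stays in a compact set, and the tube lemma
  extends goodness of all enumerations from \<open>c0\<close> to a neighbourhood.\<close>

lemma open_generic_at_infinity:
  assumes E: "closed E" and res: "d \<ge> 1 \<Longrightarrow> -1 \<in> E \<and> -1/2 \<in> E"
  shows "open {c. generic_at_infinity E d n c}"
proof (subst open_subopen, intro ballI)
  fix c0 assume "c0 \<in> {c. generic_at_infinity E d n c}"
  then have c0: "generic_at_infinity E d n c0" by simp
  let ?T = "UNIV :: (bool \<times> nat \<times> nat \<Rightarrow> complex) set"
  define \<delta> where "\<delta> = norm (c0 (False, 0, n)) / 2"
  have lead0: "c0 (False, 0, n) \<noteq> 0" and \<delta>: "\<delta> > 0" "norm (c0 (False, 0, n)) > \<delta>"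
    using c0 by (auto simp: \<delta>_def generic_at_infinity_def)
  define B where "B = (\<Sum>i\<le>n. norm (coeff (radial_poly c0 n) i)) + 1"
  have B: "norm (coeff (radial_poly c0 n) i) < B" if "i \<le> n" for i
    using that member_le_sum[of i "{..n}" "\<lambda>i. norm (coeff (radial_poly c0 n) i)"] by (auto simp: B_def)
  \<comment> \<open>Near \<open>c0\<close> the leading coefficient stays away from 0 and the others
    stay bounded, so that all roots lie in a common disc.\<close>
  define U where "U = {c. \<delta> < norm (c (False, 0, n))} \<inter> (\<Inter>i\<in>{..n}. {c. norm (coeff (radial_poly c n) i) < B})"
  have "open {c. norm (coeff (radial_poly c n) i) < B}" for i
    by (intro open_Collect_less continuous_intros continuous_on_coeff_radial_poly)
  moreover have "open {c :: bool \<times> nat \<times> nat \<Rightarrow> complex. \<delta> < norm (c (False, 0, n))}"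
    by (intro open_Collect_less continuous_intros) auto
  ultimately have U: "open U"
    unfolding U_def by (intro open_Int open_INT) auto
  define R where "R = max 1 (of_nat (Suc n) * B / \<delta>)"
  define K where "K = {v :: nat \<Rightarrow> complex. \<forall>i. norm (v i) \<le> R}"
  define F where "F = {x :: (bool \<times> nat \<times> nat \<Rightarrow> complex) \<times> (nat \<Rightarrow> complex).
      \<forall>z. poly (radial_poly (fst x) n) z = - fst x (False, 0, n) * (\<Prod>i\<le>n. z - snd x i)}"
  have F_iff: "(c, v) \<in> F \<longleftrightarrow> radial_poly c n = smult (- c (False, 0, n)) (\<Prod>i\<le>n. [:- v i, 1:])" for c v
    unfolding F_def by (auto simp: poly_eq_poly_eq_iff[symmetric] fun_eq_iff poly_prod)
  have "closed F"
    unfolding F_def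
  proof (intro closed_Collect_all closed_Collect_eq)
    fix z :: complex
    have coord: "continuous_on UNIV (\<lambda>x :: (bool \<times> nat \<times> nat \<Rightarrow> complex) \<times> (nat \<Rightarrow> complex). snd x i)"
      "continuous_on UNIV (\<lambda>x :: (bool \<times> nat \<times> nat \<Rightarrow> complex) \<times> (nat \<Rightarrow> complex). fst x j)" for i j
      by (rule continuous_on_product_then_coordinatewise[OF continuous_on_snd[OF continuous_on_id]],
          rule continuous_on_product_then_coordinatewise[OF continuous_on_fst[OF continuous_on_id]])
    show "continuous_on UNIV (\<lambda>x :: (bool \<times> nat \<times> nat \<Rightarrow> complex) \<times> (nat \<Rightarrow> complex). poly (radial_poly (fst x) n) z)"
      by (intro cont_poly_eval cont_poly_radial_poly continuous_intros)
    show "continuous_on UNIV (\<lambda>x :: (bool \<times> nat \<times> nat \<Rightarrow> complex) \<times> (nat \<Rightarrow> complex). - fst x (False, 0, n) * (\<Prod>i\<le>n. z - snd x i))"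
      by (intro continuous_intros coord)
  qed
  then have "open (- F \<union> generic_tuple E d n)"
    using open_generic_tuple[OF E res] by (intro open_Un) auto
  \<comment> \<open>A tuple that does not enumerate the roots of \<open>c0\<close> is outside
    \<open>F\<close>; one that does is good, because genericity does not depend on the
    enumeration.\<close>
  moreover have "{c0} \<times> K \<subseteq> - F \<union> generic_tuple E d n"
    using c0 lead0 by (auto simp: F_iff generic_at_infinity_iff_tuple)
  moreover have "compact K"
    unfolding K_def by (rule compact_function_ball)
  ultimately obtain X where X: "c0 \<in> X" "open X" "X \<times> K \<subseteq> - F \<union> generic_tuple E d n"
    using Elementary_Topology.tube_lemma[of K "- F \<union> generic_tuple E d n" c0] by metis
  have "generic_at_infinity E d n c" if c: "c \<in> X \<inter> U" for c
  proof -
    have lead: "c (False, 0, n) \<noteq> 0"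
      using c \<delta> by (auto simp: U_def)
    obtain w where w: "smult (lead_coeff (radial_poly c n)) (\<Prod>i<degree (radial_poly c n). [:- w i, 1:]) = radial_poly c n"
      by (rule complex_poly_decompose')
    \<comment> \<open>Entries beyond n are set to 0 to keep the sequence inside
      \<open>K\<close>.\<close>
    define v where "v i = (if i \<le> n then w i else 0)" for i
    have fact: "radial_poly c n = smult (- c (False, 0, n)) (\<Prod>i\<le>n. [:- v i, 1:])"
    proof -
      have "smult (- c (False, 0, n)) (\<Prod>i<Suc n. [:- w i, 1:]) = radial_poly c n"
        using w by (simp only: lead_coeff_radial_poly[of c n, OF lead], simp only: degree_radial_poly[of c n, OF lead])
      then show ?thesis
        by (simp add: v_def lessThan_Suc_atMost)
    qed
    have "norm (v i) \<le> R" for i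
    proof (cases "i \<le> n")
      case True
      have "poly (radial_poly c n) (v i) = 0"
        unfolding fact using True by (auto simp: poly_prod)
      then show ?thesis
        unfolding R_def using c \<delta>
        by (intro root_norm_bound[of "radial_poly c n"] degree_radial_poly_le)
          (auto simp: U_def coeff_radial_poly_Suc intro: less_imp_le)
    next
      case False
      then show ?thesis by (simp add: v_def R_def)
    qed
    then have "v \<in> K" by (simp add: K_def)
    then have "(c, v) \<in> generic_tuple E d n"
      using X(3) c fact by (auto simp: F_iff)
    then show ?thesis
      using generic_at_infinity_iff_tuple[OF lead fact] by simp
  qed
  moreover have "c0 \<in> X \<inter> U"
    using X(1) \<delta> B by (auto simp: U_def)
  ultimately show "\<exists>T. open T \<and> c0 \<in> T \<and> T \<subseteq> {c. generic_at_infinity E d n c}"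
    using X(2) U by (intro exI[of _ "X \<inter> U"]) auto
qed

subsection \<open>Density of the generic conditions\<close>

lemma radial_poly_simple_roots:
  assumes lead: "c (False, 0, n) \<noteq> 0"
    and simple: "\<And>t. poly (radial_poly c n) t = 0 \<Longrightarrow> poly (pderiv (radial_poly c n)) t \<noteq> 0"
  defines "Z \<equiv> {t. poly (radial_poly c n) t = 0}"
  shows "finite Z" "card Z = Suc n"
    "radial_poly c n = smult (- c (False, 0, n)) (\<Prod>z\<in>Z. [:- z, 1:])"
proof -
  have "radial_poly c n \<noteq> 0"
    using lead coeff_radial_poly_Suc[of c n] by auto
  then show fin: "finite Z"
    unfolding Z_def by (rule poly_roots_finite)
  have "rsquarefree (radial_poly c n)"
    using simple by (auto simp: rsquarefree_roots)
  from complex_poly_decompose_rsquarefree[OF this]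
  show fact: "radial_poly c n = smult (- c (False, 0, n)) (\<Prod>z\<in>Z. [:- z, 1:])"
    by (simp only: lead_coeff_radial_poly[of c n, OF lead] Z_def)
  have "Suc n = degree (\<Prod>z\<in>Z. [:- z, 1:])"
    using degree_radial_poly[of c n, OF lead] lead unfolding fact by simp
  also have "\<dots> = card Z"
    by (subst degree_prod_eq_sum_degree) auto
  finally show "card Z = Suc n" ..
qed

lemma pderiv_radial_poly_root:
  assumes fact: "radial_poly c n = smult l (\<Prod>z\<in>Z. [:- z, 1:])"
    and Z: "finite Z" "t \<in> Z"
  shows "poly (pderiv (radial_poly c n)) t = l * (\<Prod>z\<in>Z - {t}. t - z)"
proof -
  have "(\<Prod>z\<in>Z. [:- z, 1:]) = [:- t, 1:] * (\<Prod>z\<in>Z - {t}. [:- z, 1:])"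
    using Z by (rule prod.remove)
  then show ?thesis
    unfolding fact
    by (simp add: pderiv_smult pderiv_mult pderiv_pCons poly_prod del: mult_pCons_left mult_pCons_right)
qed

lemma degree_prod_linear:
  assumes "finite Z"
  shows "degree (\<Prod>z\<in>Z. [:- z, 1:] :: complex poly) = card Z" "coeff (\<Prod>z\<in>Z. [:- z, 1:] :: complex poly) (card Z) = 1"
proof -
  show deg: "degree (\<Prod>z\<in>Z. [:- z, 1:] :: complex poly) = card Z"
    by (subst degree_prod_eq_sum_degree) auto
  have "lead_coeff (\<Prod>z\<in>Z. [:- z, 1:] :: complex poly) = 1"
    unfolding lead_coeff_prod by simp
  then show "coeff (\<Prod>z\<in>Z. [:- z, 1:] :: complex poly) (card Z) = 1"
    by (simp only: deg)
qed

text \<open>Lagrange interpolation of p at the n + 1 roots of r; compare the coefficients of z^n,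
  which is \<open>c (False, 0, n)\<close> for p, while r has leading coefficient
  \<open>- c (False, 0, n)\<close>.\<close>

lemma sum_eigenvalue_ratios:
  assumes lead: "c (False, 0, n) \<noteq> 0"
    and simple: "\<And>t. poly (radial_poly c n) t = 0 \<Longrightarrow> poly (pderiv (radial_poly c n)) t \<noteq> 0"
  defines "Z \<equiv> {t. poly (radial_poly c n) t = 0}"
  shows "(\<Sum>t\<in>Z. poly (form_poly c False n) t / poly (pderiv (radial_poly c n)) t) = - 1"
proof -
  let ?p = "form_poly c False n" and ?r = "radial_poly c n" and ?l = "- c (False, 0, n)"
  note Z = radial_poly_simple_roots[of c n, OF lead simple, folded Z_def]
  define W where "W t = (\<Prod>z\<in>Z - {t}. [:- z, 1:] :: complex poly)" for t
  \<comment> \<open>The interpolation polynomial: the weight of \<open>W t\<close> equals p(t) /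
    W_t(t), because r'(t) is the leading coefficient times W_t(t).\<close>
  define L where "L = (\<Sum>t\<in>Z. smult (poly ?p t / poly (pderiv ?r) t * ?l) (W t))"
  have card: "card (Z - {t}) = n" if "t \<in> Z" for t
    using Z(1,2) that by simp
  have W: "degree (W t) = n" "coeff (W t) n = 1" if "t \<in> Z" for t
    using degree_prod_linear[of "Z - {t}"] card[OF that] Z(1) by (auto simp: W_def)
  have r': "poly (pderiv ?r) t = ?l * poly (W t) t" if "t \<in> Z" for t
    using pderiv_radial_poly_root[OF Z(3,1) that] by (simp add: W_def poly_prod)
  have "?p = L"
  proof (rule poly_eqI_degree[of Z])
    fix s assume s: "s \<in> Z"
    have "poly (W t) s = 0" if "t \<in> Z - {s}" for t
      using that s Z(1) by (auto simp: W_def poly_prod)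
    then have "poly L s = poly ?p s / poly (pderiv ?r) s * ?l * poly (W s) s"
      unfolding L_def poly_sum poly_smult using Z(1) s by (subst sum.remove[of _ s]) auto
    also have "\<dots> = poly ?p s / poly (pderiv ?r) s * poly (pderiv ?r) s"
      by (simp only: r'[OF s] mult.assoc)
    also have "\<dots> = poly ?p s"
      using simple s by (simp add: Z_def)
    finally show "poly ?p s = poly L s" ..
  next
    have "degree ?p \<le> n"
      by (rule degree_le) (simp add: coeff_form_poly)
    then show "card Z > degree ?p" using Z(2) by simp
    have "degree L \<le> n"
      unfolding L_def
    proof (rule degree_sum_le[OF Z(1)])
      fix t assume "t \<in> Z"
      then show "degree (smult (poly ?p t / poly (pderiv ?r) t * ?l) (W t)) \<le> n"
        using degree_smult_le[of _ "W t"] W(1)[of t] by simp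
    qed
    then show "card Z > degree L" using Z(2) by simp
  qed
  then have "coeff ?p n = coeff L n" by simp
  also have "\<dots> = (\<Sum>t\<in>Z. poly ?p t / poly (pderiv ?r) t * ?l)"
    unfolding L_def coeff_sum coeff_smult by (intro sum.cong refl) (simp add: W)
  also have "\<dots> = (\<Sum>t\<in>Z. poly ?p t / poly (pderiv ?r) t) * ?l"
    by (simp only: sum_distrib_right)
  finally have "c (False, 0, n) = (\<Sum>t\<in>Z. poly ?p t / poly (pderiv ?r) t) * ?l"
    by (simp add: coeff_form_poly)
  then have "c (False, 0, n) * (\<Sum>t\<in>Z. poly ?p t / poly (pderiv ?r) t) = c (False, 0, n) * (- 1)"
    by (metis minus_minus mult.commute mult_minus1_right mult_minus_right)
  then show ?thesis
    using lead by (subst (asm) mult_left_cancel)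
qed

lemma sum_list_map_eq_sum_of_nat_count:
  fixes f :: "'b \<Rightarrow> 'a::comm_semiring_1"
  assumes "set xs \<subseteq> X" "finite X"
  shows "(\<Sum>x\<leftarrow>xs. f x) = (\<Sum>x\<in>X. of_nat (count_list xs x) * f x)"
  using assms(1)
proof (induction xs)
  case (Cons y xs)
  have "(\<Sum>x\<in>X. of_nat (count_list (y # xs) x) * f x) =
      (\<Sum>x\<in>X. (if x = y then f y else 0) + of_nat (count_list xs x) * f x)"
    by (intro sum.cong refl) (auto simp: algebra_simps)
  also have "\<dots> = f y + (\<Sum>x\<in>X. of_nat (count_list xs x) * f x)"
    using Cons.prems assms(2) by (simp add: sum.distrib)
  finally show ?case
    using Cons by simp
qed simp

text \<open>Otherwise a t = C (2 rho(t) + 1), where a t counts t in ts and rho(t) is the quotient avoiding E; summing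
  over all roots, where the rho(t) add up to -1, gives C = length ts / (n - 1), so rho(t) is one of the rational numbers in E.\<close>
lemma moments_nonzero:
  assumes lead: "c (False, 0, n) \<noteq> 0"
    and root: "\<And>t. poly (radial_poly c n) t = 0 \<Longrightarrow> poly (pderiv (radial_poly c n)) t \<noteq> 0 \<and>
      poly (form_poly c False n) t / poly (pderiv (radial_poly c n)) t \<notin> E"
    and n: "n \<ge> 2"
    and E: "\<And>a m. a \<le> m \<Longrightarrow> 1 \<le> m \<Longrightarrow> m \<le> d \<Longrightarrow> (of_nat a * of_nat (n - 1) / of_nat m - 1) / 2 \<in> E"
    and ts: "set ts \<subseteq> {t. poly (radial_poly c n) t = 0}" "1 \<le> length ts" "length ts \<le> d"
  shows "\<exists>j<n. (\<Sum>t\<leftarrow>ts. t ^ j / (2 * poly (form_poly c False n) t + poly (pderiv (radial_poly c n)) t)) \<noteq> 0"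
proof (rule ccontr)
  let ?p = "\<lambda>t. poly (form_poly c False n) t" and ?r' = "\<lambda>t. poly (pderiv (radial_poly c n)) t"
  let ?l = "- c (False, 0, n)"
  assume neg: "\<not> ?thesis"
  define Z where "Z = {t. poly (radial_poly c n) t = 0}"
  have simple: "\<And>t. poly (radial_poly c n) t = 0 \<Longrightarrow> ?r' t \<noteq> 0"
    using root by blast
  note Z = radial_poly_simple_roots[of c n, OF lead simple, folded Z_def]
  define a where "a t = (of_nat (count_list ts t) :: complex)" for t
  define \<beta> where "\<beta> t = a t / (2 * ?p t + ?r' t)" for t
  have moment: "(\<Sum>t\<in>Z. \<beta> t * t ^ j) = 0" if "j < n" for j
  proof -
    have "(\<Sum>t\<leftarrow>ts. t ^ j / (2 * ?p t + ?r' t)) = (\<Sum>t\<in>Z. a t * (t ^ j / (2 * ?p t + ?r' t)))"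
      unfolding a_def using ts(1) Z(1) by (intro sum_list_map_eq_sum_of_nat_count) (auto simp: Z_def)
    with neg that show ?thesis
      by (simp add: \<beta>_def)
  qed
  have functional: "(\<Sum>t\<in>Z. \<beta> t * poly w t) = 0" if "degree w < n" for w
  proof -
    have "(\<Sum>t\<in>Z. \<beta> t * poly w t) = (\<Sum>t\<in>Z. \<Sum>j\<le>degree w. coeff w j * (\<beta> t * t ^ j))"
      unfolding poly_altdef sum_distrib_left by (simp add: mult_ac)
    also have "\<dots> = (\<Sum>j\<le>degree w. coeff w j * (\<Sum>t\<in>Z. \<beta> t * t ^ j))"
      unfolding sum_distrib_left by (rule sum.swap)
    also have "\<dots> = 0"
      using moment that by (intro sum.neutral) auto
    finally show ?thesis .
  qed
  have const: "\<beta> s * ?r' s = \<beta> t * ?r' t" if st: "s \<in> Z" "t \<in> Z" "s \<noteq> t" for s t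
  proof -
    \<comment> \<open>With this w, of degree n - 1, only the terms of s and t survive. The outcome
      is that \<beta> is proportional to 1/r': up to a factor, the divided difference is the only
      functional on n + 1 points that kills all degrees below n.\<close>
    define w where "w = (\<Prod>z\<in>Z - {s} - {t}. [:- z, 1:] :: complex poly)"
    have "degree w = n - 1"
      unfolding w_def using Z(1,2) st by (subst degree_prod_linear) auto
    then have "(\<Sum>z\<in>Z. \<beta> z * poly w z) = 0"
      using functional[of w] n by simp
    moreover have "(\<Sum>z\<in>Z. \<beta> z * poly w z) = \<beta> s * poly w s + \<beta> t * poly w t"
    proof -
      have "(\<Sum>z\<in>Z. \<beta> z * poly w z) = (\<Sum>z\<in>{s, t}. \<beta> z * poly w z)"
        using st Z(1) by (intro sum.mono_neutral_right) (auto simp: w_def poly_prod)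
      then show ?thesis using st by simp
    qed
    ultimately have eq: "\<beta> s * poly w s + \<beta> t * poly w t = 0" by simp
    have rs: "?r' s = ?l * ((s - t) * poly w s)"
      using pderiv_radial_poly_root[OF Z(3,1) st(1)] prod.remove[of "Z - {s}" t "\<lambda>z. s - z"] Z(1) st
      by (simp add: w_def poly_prod)
    have rt: "?r' t = ?l * ((t - s) * poly w t)"
      using pderiv_radial_poly_root[OF Z(3,1) st(2)] prod.remove[of "Z - {t}" s "\<lambda>z. t - z"] Z(1) st
      by (simp add: w_def poly_prod Diff_insert2[symmetric] insert_commute)
    show ?thesis
      unfolding rs rt using eq by algebra
  qed
  obtain t0 where t0: "t0 \<in> Z"
    using Z(2) by (metis card.empty ex_in_conv nat.distinct(1))
  define C where "C = \<beta> t0 * ?r' t0"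
  have C: "\<beta> t * ?r' t = C" if "t \<in> Z" for t
    using const[OF that t0] by (cases "t = t0") (auto simp: C_def)
  have d: "d \<ge> 1" using ts by simp
  have a_eq: "a t = C * (2 * (?p t / ?r' t) + 1)" if t: "t \<in> Z" for t
  proof -
    \<comment> \<open>The member of E for a = 0, m = 1 is -1/2, which keeps 2 p + r' away from
      0.\<close>
    have r': "?r' t \<noteq> 0" "?p t / ?r' t \<noteq> - 1 / 2"
      using root[of t] E[of 0 1] d t by (auto simp: Z_def)
    then have den: "2 * ?p t + ?r' t \<noteq> 0"
      by (auto simp: field_simps add_eq_0_iff2)
    have "C * (2 * (?p t / ?r' t) + 1) = a t / (2 * ?p t + ?r' t) * ?r' t * (2 * (?p t / ?r' t) + 1)"
      using C[OF t] by (simp add: \<beta>_def)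
    also have "\<dots> = a t"
      using r'(1) den by (simp add: field_simps)
    finally show ?thesis ..
  qed
  define m where "m = length ts"
  have "(\<Sum>t\<in>Z. a t) = of_nat m"
  proof -
    have "(\<Sum>t\<in>Z. count_list ts t) = m"
      using sum_list_map_eq_sum_of_nat_count[of ts Z "\<lambda>_. 1 :: nat"] ts(1) Z(1)
      by (simp add: Z_def m_def sum_list_triv)
    then show ?thesis
      unfolding a_def of_nat_sum[symmetric] by simp
  qed
  \<comment> \<open>The factor is 2 (-1) + (n + 1): the ratios add up to -1 and there are n + 1
    roots.\<close>
  moreover have "(\<Sum>t\<in>Z. a t) = C * (of_nat n - 1)"
  proof -
    have "(\<Sum>t\<in>Z. a t) = (\<Sum>t\<in>Z. C * (2 * (?p t / ?r' t) + 1))"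
      by (intro sum.cong refl a_eq)
    also have "\<dots> = C * (2 * (\<Sum>t\<in>Z. ?p t / ?r' t) + of_nat (card Z))"
      by (simp add: sum_distrib_left sum.distrib distrib_left mult_ac)
    also have "(\<Sum>t\<in>Z. ?p t / ?r' t) = - 1"
      unfolding Z_def by (rule sum_eigenvalue_ratios[of c n, OF lead simple])
    finally show ?thesis using Z(2) by simp
  qed
  ultimately have Cm: "C * of_nat (n - 1) = of_nat m"
    using n by (simp add: of_nat_diff)
  have m: "m \<ge> 1" "m \<le> d" using ts by (auto simp: m_def)
  then have "C \<noteq> 0" using Cm by auto
  have "count_list ts t0 \<le> m"
    by (simp add: m_def count_le_length)
  then have "(of_nat (count_list ts t0) * of_nat (n - 1) / of_nat m - 1) / 2 \<in> E"
    using E m by blast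
  moreover have "(of_nat (count_list ts t0) * of_nat (n - 1) / of_nat m - 1) / 2 = ?p t0 / ?r' t0"
  proof -
    have "of_nat (count_list ts t0) * of_nat (n - 1) / of_nat m = 2 * (?p t0 / ?r' t0) + 1"
      unfolding a_def[symmetric] a_eq[OF t0] Cm[symmetric] using \<open>C \<noteq> 0\<close> n by simp
    then show ?thesis by simp
  qed
  ultimately show False
    using root[of t0] t0 by (simp add: Z_def)
qed

section \<open>Perturbations of the coefficients over the real and the complex numbers\<close>

lemma finite_coeff_index: "finite (coeff_index n)"
  by (rule finite_subset[of _ "UNIV \<times> {..n} \<times> {..n}"]) (auto simp: coeff_index_def)

lemma form_poly_cong:
  assumes "\<And>i. i \<in> coeff_index n \<Longrightarrow> c i = c' i" "N \<le> n"
  shows "form_poly c b N = form_poly c' b N"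
  by (rule poly_eqI) (use assms in \<open>auto simp: coeff_form_poly coeff_index_def\<close>)

lemma generic_at_infinity_cong:
  assumes "\<And>i. i \<in> coeff_index n \<Longrightarrow> c i = c' i" "generic_at_infinity E d n c"
  shows "generic_at_infinity E d n c'"
proof -
  have form: "form_poly c b N = form_poly c' b N" if "N \<le> n" for b N
    using form_poly_cong[OF assms(1) that] .
  then have radial: "radial_poly c N = radial_poly c' N" if "N \<le> n" for N
    using that by (simp add: radial_poly_def)
  have "sep_coeff c n = sep_coeff c' n"
    unfolding sep_coeff_def by (simp add: form radial)
  moreover have "c (False, 0, n) = c' (False, 0, n)"
    using assms(1) by (simp add: coeff_index_def)
  ultimately show ?thesis
    using assms(2) by (simp add: generic_at_infinity_def form radial)
qed

lemma form_poly_add: "form_poly (\<lambda>i. c i + c' i) b N = form_poly c b N + form_poly c' b N"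
  by (rule poly_eqI) (simp add: coeff_form_poly)

lemma radial_poly_add: "radial_poly (\<lambda>i. c i + c' i) N = radial_poly c N + radial_poly c' N"
  by (simp add: radial_poly_def form_poly_add)

text \<open>Degree n - 2 enters \<open>sep_coeff\<close> only through one linear term of the
  numerator; the local c1 and both denominators come from degrees n and n - 1.\<close>

lemma sep_coeff_shift:
  assumes "form_poly c' False n = 0" "form_poly c' False (n - 1) = 0"
    "radial_poly c' n = 0" "radial_poly c' (n - 1) = 0"
  shows "sep_coeff (\<lambda>i. c i + c' i) n t = sep_coeff c n t
     - poly (radial_poly c' (n - 2)) t / (2 * poly (form_poly c False n) t + poly (pderiv (radial_poly c n)) t)"
  unfolding sep_coeff_def Let_def form_poly_add radial_poly_add assms add_0_right poly_add
  by (simp add: add_divide_distrib diff_divide_distrib)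

text \<open>Genericity is tested over C in both cases, since a real field may have nonreal points at
  infinity; only the perturbation parameter runs over the scalar field. Injectivity keeps preimages
  of countable sets countable.\<close>

locale scalar_embedding =
  fixes \<iota> :: "'a::{euclidean_space, real_normed_field} \<Rightarrow> complex"
  assumes emb_add: "\<iota> (x + y) = \<iota> x + \<iota> y"
    and emb_mult: "\<iota> (x * y) = \<iota> x * \<iota> y"
    and emb_one: "\<iota> 1 = 1"
    and emb_continuous: "continuous_on UNIV \<iota>"
    and emb_inj: "inj \<iota>"
begin

lemma emb_zero [simp]: "\<iota> 0 = 0"
  using emb_add[of 0 0] by simp

lemma emb_uminus: "\<iota> (- x) = - \<iota> x"
  using emb_add[of x "- x"] by (simp add: eq_neg_iff_add_eq_0 add.commute)

lemma emb_power: "\<iota> (x ^ k) = \<iota> x ^ k"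
  by (induction k) (auto simp: emb_one emb_mult)

lemma AE_emb_notin:
  assumes "countable Z"
  shows "AE s in lborel. \<iota> s \<notin> Z"
proof -
  have "countable (\<iota> -` Z)"
    using countable_subset[OF image_vimage_subset assms] emb_inj
    by (rule countable_image_inj_on[OF _ inj_on_subset]) simp
  then show ?thesis
    using AE_not_in[OF countable_imp_null_set_lborel] by force
qed

lemma open_emb_vimage:
  assumes "open {c. Q c}"
  shows "open {x :: 'i \<Rightarrow> 'a. Q (\<iota> \<circ> x)}"
proof -
  have "continuous_on UNIV (\<lambda>x :: 'i \<Rightarrow> 'a. \<iota> \<circ> x)"
    unfolding o_def
    by (intro continuous_on_coordinatewise_then_product continuous_on_compose2[OF emb_continuous]) auto
  then show ?thesis
    using assms continuous_on_open_vimage[of UNIV "\<lambda>x :: 'i \<Rightarrow> 'a. \<iota> \<circ> x"] by (auto simp: vimage_def)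
qed

text \<open>Openness makes the exceptional set measurable, as Tonelli requires; \<open>cong\<close>
  disposes of the entries outside I.\<close>

lemma AE_open_along_curves:
  fixes \<tau> :: "'a \<Rightarrow> 'i::countable \<Rightarrow> 'a"
  assumes I: "finite I" and op: "open {c. Q c}"
    and cong: "\<And>c c'. (\<And>i. i \<in> I \<Longrightarrow> c i = c' i) \<Longrightarrow> Q c \<Longrightarrow> Q c'"
    and \<tau>: "\<And>i. i \<in> I \<Longrightarrow> (\<lambda>s. \<tau> s i) \<in> borel_measurable borel"
    and step: "AE x in PiM I (\<lambda>_. lborel). AE s in lborel. Q (\<lambda>i. \<iota> (x i) + \<iota> (\<tau> s i))"
  shows "AE x in PiM I (\<lambda>_. lborel). Q (\<iota> \<circ> x)"
proof -
  let ?M = "PiM I (\<lambda>_. lborel :: 'a measure)"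
  define N where "N = space ?M - {x. Q (\<iota> \<circ> x)} \<inter> space ?M"
  have N: "N \<in> sets ?M"
    unfolding N_def by (intro sets.compl_sets sets_PiM_lborel_open open_emb_vimage op)
  have Q: "(\<lambda>i\<in>I. x i + \<tau> s i) \<notin> N" if "Q (\<lambda>i. \<iota> (x i) + \<iota> (\<tau> s i))" for x s
  proof -
    have "Q (\<iota> \<circ> (\<lambda>i\<in>I. x i + \<tau> s i))"
      using that by (rule cong[rotated]) (simp add: emb_add)
    then show ?thesis by (simp add: N_def)
  qed
  have "AE x in ?M. x \<notin> N"
  proof (rule AE_along_curves[OF I N \<tau>])
    show "AE x in ?M. AE s in lborel. (\<lambda>i\<in>I. x i + \<tau> s i) \<notin> N"
      by (rule eventually_mono[OF step], erule eventually_mono) (rule Q)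
  qed
  then show ?thesis
    by (rule AE_mp) (auto simp: N_def)
qed

lemma AE_lead_nonzero:
  "AE x in PiM (coeff_index n) (\<lambda>_. lborel). \<iota> (x (False, 0, n)) \<noteq> 0"
proof -
  define \<tau> where "\<tau> s i = (if i = (False, 0, n) then s else 0)" for s :: 'a and i :: "bool \<times> nat \<times> nat"
  have "AE x in PiM (coeff_index n) (\<lambda>_. lborel :: 'a measure). (\<iota> \<circ> x) (False, 0, n) \<noteq> 0"
  proof (rule AE_open_along_curves[OF finite_coeff_index, where \<tau> = \<tau>])
    show "open {c :: bool \<times> nat \<times> nat \<Rightarrow> complex. c (False, 0, n) \<noteq> 0}"
      by (intro open_Collect_neq continuous_intros) auto
    have "AE s in lborel. \<iota> (x (False, 0, n)) + \<iota> (\<tau> s (False, 0, n)) \<noteq> 0" for x :: "bool \<times> nat \<times> nat \<Rightarrow> 'a"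
      using AE_emb_notin[of "{- \<iota> (x (False, 0, n))}"]
      by (auto elim!: eventually_mono simp: \<tau>_def add_eq_0_iff)
    then show "AE x in PiM (coeff_index n) (\<lambda>_. lborel). AE s in lborel. \<iota> (x (False, 0, n)) + \<iota> (\<tau> s (False, 0, n)) \<noteq> 0"
      by simp
  qed (auto simp: \<tau>_def coeff_index_def)
  then show ?thesis by simp
qed

text \<open>Changing the coefficient of x^n in Q adds a constant s to the radial polynomial r, and r
  + s has a multiple root only if -s is one of the finitely many critical values of r. The arguments
  \<open>{}\<close> and 0 switch off the conditions on ratios and sums.\<close>

lemma AE_simple_roots:
  "AE x in PiM (coeff_index n) (\<lambda>_. lborel). generic_at_infinity {} 0 n (\<iota> \<circ> x)"
proof -
  define \<tau> where "\<tau> s i = (if i = (True, n, 0) then s else 0)" for s :: 'a and i :: "bool \<times> nat \<times> nat"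
  have "generic_at_infinity {} 0 n (\<lambda>i. \<iota> (x i) + \<iota> (\<tau> s i))"
    if lead: "\<iota> (x (False, 0, n)) \<noteq> 0"
      and s: "\<iota> s \<notin> (\<lambda>t. - poly (radial_poly (\<iota> \<circ> x) n) t) ` {t. poly (pderiv (radial_poly (\<iota> \<circ> x) n)) t = 0}" for x s
  proof -
    have "radial_poly (\<lambda>i. \<iota> (\<tau> s i)) n = [:\<iota> s:]"
      by (rule poly_eqI) (auto simp: radial_poly_def coeff_form_poly \<tau>_def coeff_pCons split: nat.splits)
    then have radial: "radial_poly (\<lambda>i. \<iota> (x i) + \<iota> (\<tau> s i)) n = radial_poly (\<iota> \<circ> x) n + [:\<iota> s:]"
      by (simp add: radial_poly_add o_def)
    have "poly (pderiv (radial_poly (\<iota> \<circ> x) n)) t \<noteq> 0" if "poly (radial_poly (\<iota> \<circ> x) n) t + \<iota> s = 0" for t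
      using s that by (auto simp: image_iff add_eq_0_iff)
    then show ?thesis
      using lead unfolding generic_at_infinity_def radial by (simp add: pderiv_add pderiv_pCons \<tau>_def) auto
  qed
  moreover have "finite {t. poly (pderiv (radial_poly (\<iota> \<circ> x) n)) t = 0}" if "\<iota> (x (False, 0, n)) \<noteq> 0" for x
  proof (rule poly_roots_finite)
    show "pderiv (radial_poly (\<iota> \<circ> x) n) \<noteq> 0"
      using degree_radial_poly[of "\<iota> \<circ> x" n] that by (simp add: pderiv_eq_0_iff)
  qed
  ultimately have step: "AE s in lborel. generic_at_infinity {} 0 n (\<lambda>i. \<iota> (x i) + \<iota> (\<tau> s i))"
    if "\<iota> (x (False, 0, n)) \<noteq> 0" for x
    using that
    by (intro eventually_mono[OF AE_emb_notin[of "(\<lambda>t. - poly (radial_poly (\<iota> \<circ> x) n) t) ` {t. poly (pderiv (radial_poly (\<iota> \<circ> x) n)) t = 0}"]])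
      (auto intro: countable_finite)
  show ?thesis
  proof (rule AE_open_along_curves[OF finite_coeff_index, where \<tau> = \<tau>])
    show "AE x in PiM (coeff_index n) (\<lambda>_. lborel). AE s in lborel.
        generic_at_infinity {} 0 n (\<lambda>i. \<iota> (x i) + \<iota> (\<tau> s i))"
      by (rule eventually_mono[OF AE_lead_nonzero step])
    show "generic_at_infinity {} 0 n c'"
      if "\<And>i. i \<in> coeff_index n \<Longrightarrow> c i = c' i" "generic_at_infinity {} 0 n c" for c c'
      using generic_at_infinity_cong[OF that] .
  qed (auto simp: \<tau>_def intro: open_generic_at_infinity)
qed

text \<open>The curve adds s x^(n-1) times the field (x, y). This leaves x Q_n - y P_n alone, hence
  the points at infinity and r', and adds s to p at each of them. The form of \<open>null\<close>
  covers countable E as well as the real line in C.\<close>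

lemma AE_ratios_avoid:
  assumes E: "closed E" and n: "n \<ge> 2"
    and null: "\<And>a b. b \<noteq> 0 \<Longrightarrow> AE s in lborel. (a + \<iota> s) / b \<notin> E"
  shows "AE x in PiM (coeff_index n) (\<lambda>_. lborel). generic_at_infinity E 0 n (\<iota> \<circ> x)"
proof -
  define \<tau> where "\<tau> s i = (if i = (False, n, 0) \<or> i = (True, n - 1, 1) then s else 0)"
    for s :: 'a and i :: "bool \<times> nat \<times> nat"
  have step: "AE s in lborel. generic_at_infinity E 0 n (\<lambda>i. \<iota> (x i) + \<iota> (\<tau> s i))"
    if x: "generic_at_infinity {} 0 n (\<iota> \<circ> x)" for x
  proof -
    let ?r = "radial_poly (\<iota> \<circ> x) n" and ?p = "form_poly (\<iota> \<circ> x) False n"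
    have lead: "\<iota> (x (False, 0, n)) \<noteq> 0" and simple: "\<And>t. poly ?r t = 0 \<Longrightarrow> poly (pderiv ?r) t \<noteq> 0"
      using x by (auto simp: generic_at_infinity_def)
    have "finite {t. poly ?r t = 0}"
      using radial_poly_simple_roots(1)[of "\<iota> \<circ> x" n] lead simple by simp
    then have "AE s in lborel. \<forall>t\<in>{t. poly ?r t = 0}. (poly ?p t + \<iota> s) / poly (pderiv ?r) t \<notin> E"
      using null simple by (intro AE_finite_allI) auto
    then show ?thesis
    proof (rule eventually_mono)
      fix s assume s: "\<forall>t\<in>{t. poly ?r t = 0}. (poly ?p t + \<iota> s) / poly (pderiv ?r) t \<notin> E"
      have form: "form_poly (\<lambda>i. \<iota> (\<tau> s i)) False n = [:\<iota> s:]"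
        by (rule poly_eqI) (auto simp: coeff_form_poly \<tau>_def coeff_pCons split: nat.splits)
      moreover have "form_poly (\<lambda>i. \<iota> (\<tau> s i)) True n = [:0, \<iota> s:]"
        using n by (intro poly_eqI) (auto simp: coeff_form_poly \<tau>_def coeff_pCons split: nat.splits)
      ultimately have "radial_poly (\<lambda>i. \<iota> (\<tau> s i)) n = 0"
        by (simp add: radial_poly_def)
      then show "generic_at_infinity E 0 n (\<lambda>i. \<iota> (x i) + \<iota> (\<tau> s i))"
        using lead simple s n unfolding generic_at_infinity_def radial_poly_add form_poly_add form
        by (simp add: o_def \<tau>_def) auto
    qed
  qed
  show ?thesis
  proof (rule AE_open_along_curves[OF finite_coeff_index, where \<tau> = \<tau>])
    show "AE x in PiM (coeff_index n) (\<lambda>_. lborel). AE s in lborel.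
        generic_at_infinity E 0 n (\<lambda>i. \<iota> (x i) + \<iota> (\<tau> s i))"
      by (rule eventually_mono[OF AE_simple_roots step])
    show "generic_at_infinity E 0 n c'"
      if "\<And>i. i \<in> coeff_index n \<Longrightarrow> c i = c' i" "generic_at_infinity E 0 n c" for c c'
      using generic_at_infinity_cong[OF that] .
  qed (auto simp: \<tau>_def intro: open_generic_at_infinity[OF E])
qed

text \<open>The radial polynomial of degree n - 2 is moved along s + s^2 z + ... + s^n z^(n-1). Each
  sum of numbers c2 becomes a polynomial in s with coefficients that are, apart from the constant
  term, minus the moments of \<open>moments_nonzero\<close>; one of these is nonzero, so only
  finitely many s are bad.\<close>

lemma AE_generic_at_infinity:
  assumes E: "closed E" and n: "n \<ge> 2"
    and null: "\<And>a b. b \<noteq> 0 \<Longrightarrow> AE s in lborel. (a + \<iota> s) / b \<notin> E"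
    and res: "-1 \<in> E"
      "\<And>a m. a \<le> m \<Longrightarrow> 1 \<le> m \<Longrightarrow> m \<le> d \<Longrightarrow> (of_nat a * of_nat (n - 1) / of_nat m - 1) / 2 \<in> E"
  shows "AE x in PiM (coeff_index n) (\<lambda>_. lborel). generic_at_infinity E d n (\<iota> \<circ> x)"
proof -
  \<comment> \<open>Q supplies z^0, ..., z^(n-2), while z^(n-1) can come only from -y P, through
    y^(n-2) in P. The exponents of s start at 1 to keep the moments apart from the constant term,
    the unperturbed sum.\<close>
  define \<tau> where "\<tau> s = (\<lambda>(b, i, j). if b \<and> i + j = n - 2 then s ^ Suc j
      else if \<not> b \<and> i = 0 \<and> j = n - 2 then - (s ^ n) else 0)" for s :: 'a
  have step: "AE s in lborel. generic_at_infinity E d n (\<lambda>i. \<iota> (x i) + \<iota> (\<tau> s i))"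
    if x: "generic_at_infinity E 0 n (\<iota> \<circ> x)" for x
  proof -
    define c where "c = \<iota> \<circ> x"
    let ?r = "radial_poly c n" and ?p = "form_poly c False n"
    let ?Z = "{t. poly ?r t = 0}"
    have lead: "c (False, 0, n) \<noteq> 0"
      and root: "\<And>t. poly ?r t = 0 \<Longrightarrow> poly (pderiv ?r) t \<noteq> 0 \<and> poly ?p t / poly (pderiv ?r) t \<notin> E"
      using x by (auto simp: generic_at_infinity_def c_def)
    define D where "D t = 2 * poly ?p t + poly (pderiv ?r) t" for t
    define M where "M ts = [:\<Sum>t\<leftarrow>ts. sep_coeff c n t:]
       - pCons 0 (\<Sum>j<n. monom (\<Sum>t\<leftarrow>ts. t ^ j / D t) j)" for ts
    define L where "L = {ts. set ts \<subseteq> ?Z \<and> length ts \<le> d} - {[]}"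
    have "finite ?Z"
      using radial_poly_simple_roots(1)[of c n] lead root by simp
    then have "finite L"
      unfolding L_def by (intro finite_Diff finite_lists_length_le)
    moreover have "finite {z. poly (M ts) z = 0}" if "ts \<in> L" for ts
    proof (rule poly_roots_finite)
      have ts: "set ts \<subseteq> ?Z" "1 \<le> length ts" "length ts \<le> d"
        using that by (cases ts; auto simp: L_def)+
      have "\<exists>j<n. (\<Sum>t\<leftarrow>ts. t ^ j / D t) \<noteq> 0"
        unfolding D_def by (rule moments_nonzero[OF lead _ n _ ts, where E = E]) (use root res(2) in blast)+
      then obtain j where j: "j < n" "(\<Sum>t\<leftarrow>ts. t ^ j / D t) \<noteq> 0" by blast
      then have "coeff (M ts) (Suc j) \<noteq> 0"
        by (simp add: M_def coeff_sum)
      then show "M ts \<noteq> 0" by auto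
    qed
    ultimately have "countable (\<Union>ts\<in>L. {z. poly (M ts) z = 0})"
      by (intro countable_finite finite_UN_I)
    from AE_emb_notin[OF this] show ?thesis
    proof (rule eventually_mono)
      fix s assume s: "\<iota> s \<notin> (\<Union>ts\<in>L. {z. poly (M ts) z = 0})"
      let ?c' = "\<lambda>i. \<iota> (\<tau> s i)"
      obtain l where l: "n = Suc (Suc l)"
        using n by (metis add_2_eq_Suc le_Suc_ex)
      have "form_poly ?c' b n = 0" for b
      proof (rule poly_eqI)
        fix k show "coeff (form_poly ?c' b n) k = coeff 0 k"
          by (cases "k \<le> n") (auto simp: coeff_form_poly \<tau>_def l)
      qed
      moreover have "form_poly ?c' b (Suc l) = 0" for b
      proof (rule poly_eqI)
        fix k show "coeff (form_poly ?c' b (Suc l)) k = coeff 0 k"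
          by (cases "k \<le> Suc l") (auto simp: coeff_form_poly \<tau>_def l)
      qed
      ultimately have form0: "form_poly ?c' b n = 0" "form_poly ?c' b (n - 1) = 0" for b
        by (simp_all add: l)
      then have radial0: "radial_poly ?c' n = 0" "radial_poly ?c' (n - 1) = 0"
        by (simp_all add: radial_poly_def)
      have "form_poly ?c' True l = (\<Sum>j\<le>l. monom (\<iota> s ^ Suc j) j)"
        unfolding form_poly_def by (intro sum.cong refl) (simp add: \<tau>_def l emb_power emb_mult)
      moreover have "form_poly ?c' False l = monom (- (\<iota> s ^ n)) l"
      proof (rule poly_eqI)
        fix k show "coeff (form_poly ?c' False l) k = coeff (monom (- (\<iota> s ^ n)) l) k"
          by (cases "k = l") (simp_all add: coeff_form_poly \<tau>_def l emb_power emb_mult emb_uminus)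
      qed
      ultimately have radial2: "radial_poly ?c' (n - 2) = (\<Sum>j<n. monom (\<iota> s ^ Suc j) j)"
        by (simp add: radial_poly_def l lessThan_Suc_atMost monom_Suc[symmetric] minus_monom del: power_Suc)
      have "(\<Sum>t\<leftarrow>ts. sep_coeff (\<lambda>i. c i + ?c' i) n t) = poly (M ts) (\<iota> s)" for ts
      proof -
        have "poly (M ts) (\<iota> s) = (\<Sum>t\<leftarrow>ts. sep_coeff c n t) - (\<Sum>j<n. \<iota> s ^ Suc j * (\<Sum>t\<leftarrow>ts. t ^ j / D t))"
          by (simp add: M_def poly_sum poly_monom sum_distrib_left mult_ac)
        also have "(\<Sum>j<n. \<iota> s ^ Suc j * (\<Sum>t\<leftarrow>ts. t ^ j / D t)) = (\<Sum>t\<leftarrow>ts. \<Sum>j<n. \<iota> s ^ Suc j * (t ^ j / D t))"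
          by (induction ts) (simp_all add: distrib_left sum.distrib)
        also have "(\<Sum>t\<leftarrow>ts. sep_coeff c n t) - \<dots> =
            (\<Sum>t\<leftarrow>ts. sep_coeff c n t - (\<Sum>j<n. \<iota> s ^ Suc j * (t ^ j / D t)))"
          by (simp only: sum_list_subtractf)
        also have "\<dots> = (\<Sum>t\<leftarrow>ts. sep_coeff (\<lambda>i. c i + ?c' i) n t)"
        proof -
          have "sep_coeff (\<lambda>i. c i + ?c' i) n t = sep_coeff c n t - (\<Sum>j<n. \<iota> s ^ Suc j * (t ^ j / D t))" for t
            unfolding sep_coeff_shift[OF form0[of False] radial0] radial2
            by (simp add: poly_sum poly_monom D_def sum_divide_distrib)
          then show ?thesis by (simp only:)
        qed
        finally show ?thesis ..
      qed
      moreover have "poly (M ts) (\<iota> s) \<noteq> 0" if "set ts \<subseteq> ?Z" "1 \<le> length ts" "length ts \<le> d" for ts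
        using s that by (auto simp: L_def)
      ultimately have "generic_at_infinity E d n (\<lambda>i. c i + ?c' i)"
        using lead root n unfolding generic_at_infinity_def radial_poly_add form_poly_add radial0 form0
        by (simp add: \<tau>_def)
      then show "generic_at_infinity E d n (\<lambda>i. \<iota> (x i) + \<iota> (\<tau> s i))"
        by (simp add: c_def)
    qed
  qed
  show ?thesis
  proof (rule AE_open_along_curves[OF finite_coeff_index, where \<tau> = \<tau>])
    show "AE x in PiM (coeff_index n) (\<lambda>_. lborel). AE s in lborel.
        generic_at_infinity E d n (\<lambda>i. \<iota> (x i) + \<iota> (\<tau> s i))"
      by (rule eventually_mono[OF AE_ratios_avoid[OF E n null] step])
    have "-1/2 \<in> E" if "d \<ge> 1"
      using res(2)[of 0 1] that by simp
    then show "open {c. generic_at_infinity E d n c}"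
      using res(1) by (intro open_generic_at_infinity[OF E]) auto
    show "(\<lambda>s. \<tau> s i) \<in> borel_measurable borel" for i
      by (cases i) (auto simp: \<tau>_def)
    show "generic_at_infinity E d n c'"
      if "\<And>i. i \<in> coeff_index n \<Longrightarrow> c i = c' i" "generic_at_infinity E d n c" for c c'
      using generic_at_infinity_cong[OF that] .
  qed
qed

end

subsection \<open>Generic vector fields\<close>

definition vf_of_coeffs :: "nat \<Rightarrow> (bool \<times> nat \<times> nat \<Rightarrow> 'a::comm_monoid_add) \<Rightarrow> 'a vector_field" where
  "vf_of_coeffs n c =
     (\<Sum>j\<le>n. monom (\<Sum>i\<le>n - j. monom (c (False, i, j)) i) j,
      \<Sum>j\<le>n. monom (\<Sum>i\<le>n - j. monom (c (True, i, j)) i) j)"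

lemma coeff_vf_of_coeffs:
  "coeff (coeff (if b then snd (vf_of_coeffs n c) else fst (vf_of_coeffs n c)) j) i =
    (if i + j \<le> n then c (b, i, j) else 0)"
proof -
  have "coeff (coeff (\<Sum>j\<le>n. monom (\<Sum>i\<le>n - j. monom (c (b, i, j)) i) j) j) i =
      (if i + j \<le> n then c (b, i, j) else 0)" for b
    by (auto simp: coeff_sum)
  then show ?thesis
    by (simp add: vf_of_coeffs_def)
qed

lemma coeff_vector_vf_of_coeffs:
  assumes "c \<in> extensional (coeff_index n)"
  shows "coeff_vector n (vf_of_coeffs n c) = c"
  using assms
  by (auto simp: coeff_vector_def coeff_vf_of_coeffs fun_eq_iff restrict_def extensional_def coeff_index_def)

lemma vf_of_coeffs_in_vector_fields:
  assumes "c (False, 0, n) \<noteq> 0"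
  shows "vf_of_coeffs n c \<in> vector_fields n"
proof -
  have "total_degree (if b then snd (vf_of_coeffs n c) else fst (vf_of_coeffs n c)) \<le> n" for b
    unfolding total_degree_le_iff coeff_vf_of_coeffs by auto
  from this[of False] this[of True]
  have "total_degree (fst (vf_of_coeffs n c)) \<le> n" "total_degree (snd (vf_of_coeffs n c)) \<le> n"
    by auto
  moreover have "coeff (coeff (fst (vf_of_coeffs n c)) n) 0 \<noteq> 0"
    using coeff_vf_of_coeffs[of False n c n 0] assms by simp
  then have "n \<le> total_degree (fst (vf_of_coeffs n c))"
    by (metis add_0 order_refl total_degree_le_iff)
  ultimately show ?thesis
    by (simp add: vector_fields_def vf_degree_def)
qed

lemma coeff_vector_extensional: "coeff_vector n X \<in> extensional (coeff_index n)"
  by (auto simp: coeff_vector_def)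

lemma full_lebesgue_measure_mono:
  assumes "full_lebesgue_measure n S" "S \<subseteq> T" "T \<subseteq> vector_fields n"
  shows "full_lebesgue_measure n T"
proof -
  have "coeff_vector n ` (vector_fields n - T) \<subseteq> coeff_vector n ` (vector_fields n - S)"
    using assms(2) by blast
  from completion.complete2[OF this] show ?thesis
    using assms(1,3) unfolding full_lebesgue_measure_def by blast
qed

context scalar_embedding
begin

definition generic_fields :: "complex set \<Rightarrow> nat \<Rightarrow> nat \<Rightarrow> 'a vector_field set" where
  "generic_fields E d n = {X \<in> vector_fields n. generic_at_infinity E d n (\<iota> \<circ> coeff_vector n X)}"

lemma generic_fields_open_dense_full:
  assumes E: "closed E" and n: "n \<ge> 2"
    and null: "\<And>a b. b \<noteq> 0 \<Longrightarrow> AE s in lborel. (a + \<iota> s) / b \<notin> E"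
    and res: "-1 \<in> E"
      "\<And>a m. a \<le> m \<Longrightarrow> 1 \<le> m \<Longrightarrow> m \<le> d \<Longrightarrow> (of_nat a * of_nat (n - 1) / of_nat m - 1) / 2 \<in> E"
  shows "open_dense_in (vf_topology n) (generic_fields E d n)"
    and "full_lebesgue_measure n (generic_fields E d n)"
proof -
  let ?I = "coeff_index n"
  let ?M = "PiM ?I (\<lambda>_. lborel :: 'a measure)"
  let ?P = "product_topology (\<lambda>_. euclidean :: 'a topology) ?I"
  define V where "V = {x :: bool \<times> nat \<times> nat \<Rightarrow> 'a. generic_at_infinity E d n (\<iota> \<circ> x)}"
  have "-1/2 \<in> E" if "d \<ge> 1"
    using res(2)[of 0 1] that by simp
  then have V: "open V"
    unfolding V_def using res(1) by (intro open_emb_vimage open_generic_at_infinity[OF E]) auto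
  have AE: "AE x in ?M. x \<in> V"
    using AE_generic_at_infinity[OF E n null res] by (simp add: V_def)
  have "generic_fields E d n = coeff_vector n -` (V \<inter> extensional ?I) \<inter> vector_fields n"
    using coeff_vector_extensional by (auto simp: generic_fields_def V_def)
  then have "openin (vf_topology n) (generic_fields E d n)"
    unfolding vf_topology_def openin_pullback_topology using openin_product_topology_open[OF V] by blast
  moreover have "generic_fields E d n \<inter> W \<noteq> {}" if W: "openin (vf_topology n) W" "W \<noteq> {}" for W
  proof -
    obtain O' where O': "openin ?P O'" "W = coeff_vector n -` O' \<inter> vector_fields n"
      using W(1) unfolding vf_topology_def openin_pullback_topology by blast
    obtain X where "X \<in> W" using W(2) by blast
    then have "coeff_vector n X \<in> O'" using O'(2) by blast
    from PiM_lborel_open_positive[OF finite_coeff_index O'(1) this AE]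
    obtain c where c: "c \<in> O'" "c \<in> V" by blast
    have "c \<in> extensional ?I"
      using openin_subset[OF O'(1)] c(1) by (auto simp: PiE_iff)
    then have cv: "coeff_vector n (vf_of_coeffs n c) = c"
      by (rule coeff_vector_vf_of_coeffs)
    \<comment> \<open>A coefficient vector may belong to a field of lower degree; this part of
      genericity rules that out.\<close>
    have "c (False, 0, n) \<noteq> 0"
      using c(2) emb_zero by (auto simp: V_def generic_at_infinity_def)
    then have "vf_of_coeffs n c \<in> vector_fields n"
      by (rule vf_of_coeffs_in_vector_fields)
    then have "vf_of_coeffs n c \<in> generic_fields E d n \<inter> W"
      using c by (auto simp: generic_fields_def O'(2) cv V_def)
    then show ?thesis by blast
  qed
  ultimately show "open_dense_in (vf_topology n) (generic_fields E d n)"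
    unfolding open_dense_in_def dense_intersects_open by blast
  define N where "N = space ?M - V \<inter> space ?M"
  have "N \<in> sets ?M"
    unfolding N_def by (intro sets.compl_sets sets_PiM_lborel_open V)
  moreover have "AE x in ?M. x \<notin> N"
    using AE by (auto elim!: eventually_mono simp: N_def)
  ultimately have "N \<in> null_sets ?M"
    by (simp add: AE_iff_null_sets)
  then have "N \<in> null_sets (completion ?M)"
    by (rule null_sets_completionI)
  moreover have "coeff_vector n ` (vector_fields n - generic_fields E d n) \<subseteq> N"
  proof (rule image_subsetI)
    fix X assume "X \<in> vector_fields n - generic_fields E d n"
    moreover have "coeff_vector n X \<in> space ?M"
      using coeff_vector_extensional[of n X] by (simp add: space_PiM PiE_def)
    ultimately show "coeff_vector n X \<in> N"
      by (simp add: N_def V_def generic_fields_def)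
  qed
  ultimately have "coeff_vector n ` (vector_fields n - generic_fields E d n) \<in> null_sets (completion ?M)"
    by (rule completion.complete2[rotated])
  then show "full_lebesgue_measure n (generic_fields E d n)"
    unfolding full_lebesgue_measure_def by (auto simp: generic_fields_def)
qed

end

interpretation real_emb: scalar_embedding complex_of_real
  by standard (auto intro!: continuous_intros simp: inj_def)

text \<open>The identity is written as a constant: with an abstraction, the simplification rule for the
  image of zero would become the looping equation \<open>0 = 0\<close>.\<close>
interpretation complex_emb: scalar_embedding "id :: complex \<Rightarrow> complex"
  by standard (simp_all add: continuous_on_id')

section \<open>Absence of invariant curves and the excluded ratios\<close>

lemma generic_nonresonant:
  assumes generic: "generic_at_infinity E d n c"
    and E: "\<And>e a. 1 \<le> e \<Longrightarrow> 1 \<le> a \<Longrightarrow> a \<le> d' \<Longrightarrow> - of_nat a / of_nat e \<in> E"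
    and "poly (radial_poly c n) t = 0" "1 \<le> e" "1 \<le> a" "a \<le> d'"
  shows "of_nat e * poly (form_poly c False n) t + of_nat a * poly (pderiv (radial_poly c n)) t \<noteq> 0"
proof
  assume eq: "of_nat e * poly (form_poly c False n) t + of_nat a * poly (pderiv (radial_poly c n)) t = 0"
  have r': "poly (pderiv (radial_poly c n)) t \<noteq> 0"
    and notin: "poly (form_poly c False n) t / poly (pderiv (radial_poly c n)) t \<notin> E"
    using assms(1,3) by (auto simp: generic_at_infinity_def)
  have "poly (form_poly c False n) t / poly (pderiv (radial_poly c n)) t = - of_nat a / of_nat e"
  proof (subst frac_eq_eq[OF r'])
    show "(of_nat e :: complex) \<noteq> 0" using assms(4) by simp
    have "of_nat e * poly (form_poly c False n) t = - (of_nat a * poly (pderiv (radial_poly c n)) t)"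
      using eq by (simp only: eq_neg_iff_add_eq_0)
    then show "poly (form_poly c False n) t * of_nat e = - of_nat a * poly (pderiv (radial_poly c n)) t"
      by (simp only: mult.commute mult_minus_left)
  qed
  then show False
    using notin E assms(4-6) by metis
qed

lemma generic_no_invariant_curve_bounded:
  assumes X: "total_degree (fst X) \<le> n" "total_degree (snd X) \<le> n" and n: "n \<ge> 2"
    and generic: "generic_at_infinity E d n (vf_coeffs X)"
    and E: "\<And>e a. 1 \<le> e \<Longrightarrow> 1 \<le> a \<Longrightarrow> a \<le> d \<Longrightarrow> - of_nat a / of_nat e \<in> E"
  shows "\<not> (invariant_algebraic_curve X G \<and> total_degree G \<le> d)"
proof
  assume "invariant_algebraic_curve X G \<and> total_degree G \<le> d"
  then obtain K where G: "total_degree G > 0" "total_degree G \<le> d"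
      "fst X * partial_x G + snd X * partial_y G = K * G"
    by (auto simp: invariant_algebraic_curve_def)
  have lead: "vf_coeffs X (False, 0, n) \<noteq> 0"
    using generic by (simp add: generic_at_infinity_def)
  have nonres: "of_nat e * poly (form_poly (vf_coeffs X) False n) t
      + of_nat a * poly (pderiv (radial_poly (vf_coeffs X) n)) t \<noteq> 0"
    if "poly (radial_poly (vf_coeffs X) n) t = 0" "1 \<le> e" "1 \<le> a" "a \<le> d" for t e a
    by (rule generic_nonresonant[OF generic _ that]) (rule E)
  from invariant_curve_relation[OF X n lead nonres G]
  obtain ts where "set ts \<subseteq> {t. poly (radial_poly (vf_coeffs X) n) t = 0}" "length ts = total_degree G"
      "(\<Sum>t\<leftarrow>ts. sep_coeff (vf_coeffs X) n t) = 0"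
    by blast
  then show False
    using generic G unfolding generic_at_infinity_def by auto
qed

lemma generic_no_invariant_curve:
  assumes X: "total_degree (fst X) \<le> n" "total_degree (snd X) \<le> n" and n: "n \<ge> 2"
    and generic: "generic_at_infinity \<real> (Suc n) n (vf_coeffs X)"
  shows "\<not> invariant_algebraic_curve X G"
proof
  assume "invariant_algebraic_curve X G"
  then obtain H where H: "prime_elem H" "invariant_algebraic_curve X H"
    using invariant_prime_factor by blast
  then obtain K where K: "total_degree H > 0" "fst X * partial_x H + snd X * partial_y H = K * H"
    by (auto simp: invariant_algebraic_curve_def)
  have lead: "vf_coeffs X (False, 0, n) \<noteq> 0"
    and simple: "\<And>t. poly (radial_poly (vf_coeffs X) n) t = 0 \<Longrightarrow> poly (pderiv (radial_poly (vf_coeffs X) n)) t \<noteq> 0"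
    using generic by (auto simp: generic_at_infinity_def)
  have E: "- of_nat a / of_nat e \<in> (\<real> :: complex set)" for a e :: nat
    by (intro Reals_divide Reals_minus Reals_of_nat)
  \<comment> \<open>The bound on a is the degree of H itself, over which there is no control yet;
    this is possible because every -a/e is real. Distinctness then bounds that degree by the number
    n + 1 of roots.\<close>
  have nonres: "of_nat e * poly (form_poly (vf_coeffs X) False n) t
      + of_nat a * poly (pderiv (radial_poly (vf_coeffs X) n)) t \<noteq> 0"
    if "poly (radial_poly (vf_coeffs X) n) t = 0" "1 \<le> e" "1 \<le> a" "a \<le> total_degree H" for t e a
    by (rule generic_nonresonant[OF generic _ that]) (rule E)
  from invariant_curve_relation[OF X n lead nonres K(1) order_refl K(2)]
  obtain ts where ts: "set ts \<subseteq> {t. poly (radial_poly (vf_coeffs X) n) t = 0}" "length ts = total_degree H"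
      "(\<Sum>t\<leftarrow>ts. sep_coeff (vf_coeffs X) n t) = 0" "distinct ts"
    using H(1) by blast
  note Z = radial_poly_simple_roots[of "vf_coeffs X" n, OF lead simple]
  have "length ts \<le> Suc n"
    using card_mono[OF Z(1) ts(1)] distinct_card[OF ts(4)] Z(2) by simp
  then show False
    using generic ts K(1) unfolding generic_at_infinity_def by auto
qed

lemma AE_ratio_not_real:
  assumes "b \<noteq> 0"
  shows "AE s in lborel. (a + id s) / b \<notin> (\<real> :: complex set)"
proof -
  \<comment> \<open>Chosen so that the inner product of v and s is Im (s * cnj b); the bad s thus
    lie on a real line in the plane.\<close>
  define v where "v = Complex (- Im b) (Re b)"
  define S where "S = {s. v \<bullet> s = - Im (a * cnj b)}"
  have "v \<noteq> 0"
    using assms by (auto simp: v_def complex_eq_iff)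
  then have "negligible S"
    unfolding S_def by (intro negligible_hyperplane) auto
  moreover have "closed S"
    unfolding S_def by (rule closed_hyperplane)
  ultimately have "S \<in> null_sets lborel"
    by (simp add: negligible_iff_null_sets null_sets_completion_iff)
  moreover have "s \<in> S" if "(a + s) / b \<in> \<real>" for s
  proof -
    have "(a + s) * cnj b = ((a + s) / b) * of_real ((cmod b)\<^sup>2)"
      using assms unfolding complex_norm_square by (simp add: mult.assoc[symmetric])
    also have "\<dots> \<in> \<real>"
      using that by (intro Reals_mult) auto
    finally have "Im ((a + s) * cnj b) = 0"
      by (simp add: complex_is_Real_iff)
    then show ?thesis
      by (simp add: S_def v_def inner_complex_def algebra_simps)
  qed
  ultimately show ?thesis
    by (intro eventually_mono[OF AE_not_in[of S]]) auto
qed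

text \<open>The insertion of 0 makes this countable set closed.\<close>
definition resonances :: "nat \<Rightarrow> nat \<Rightarrow> complex set" where
  "resonances n d = (\<Union>a\<le>d. insert 0 (range (\<lambda>e. - of_nat a / of_nat (Suc e)))) \<union>
     (\<lambda>(a, m). (of_nat a * of_nat (n - 1) / of_nat m - 1) / 2) ` ({..d} \<times> {..d})"

lemma closed_resonances: "closed (resonances n d)"
proof -
  have "compact (insert 0 (range (\<lambda>e. - of_nat a / of_nat (Suc e) :: complex)))" for a
    by (intro compact_sequence_with_limit tendsto_divide_0[OF tendsto_const]
        filterlim_compose[OF tendsto_of_nat filterlim_Suc])
  then show ?thesis
    unfolding resonances_def
    by (intro closed_Un closed_UN ballI compact_imp_closed finite_atMost
        finite_imp_closed[OF finite_imageI] finite_cartesian_product)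
qed

lemma countable_resonances: "countable (resonances n d)"
  unfolding resonances_def by (intro countable_Un countable_UN) auto

lemma AE_ratio_not_resonant:
  assumes "b \<noteq> 0"
  shows "AE s in (lborel :: real measure). (a + complex_of_real s) / b \<notin> resonances n d"
proof -
  have "AE s in (lborel :: real measure). complex_of_real s \<notin> (\<lambda>z. z * b - a) ` resonances n d"
    by (intro real_emb.AE_emb_notin countable_image countable_resonances)
  then show ?thesis
  proof (rule eventually_mono, intro notI)
    fix s assume "complex_of_real s \<notin> (\<lambda>z. z * b - a) ` resonances n d"
      and "(a + complex_of_real s) / b \<in> resonances n d"
    moreover have "complex_of_real s = ((a + complex_of_real s) / b) * b - a"
      using assms by simp
    ultimately show False by blast
  qed
qed

lemma resonances_memberI:
  shows "1 \<le> e \<Longrightarrow> a \<le> d \<Longrightarrow> - of_nat a / of_nat e \<in> resonances n d"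
    and "a \<le> m \<Longrightarrow> m \<le> d \<Longrightarrow> (of_nat a * of_nat (n - 1) / of_nat m - 1) / 2 \<in> resonances n d"
proof -
  assume "1 \<le> e" "a \<le> d"
  then obtain k where "e = Suc k" by (metis Suc_le_D One_nat_def)
  then show "- of_nat a / of_nat e \<in> resonances n d"
    unfolding resonances_def using \<open>a \<le> d\<close> by blast
next
  assume "a \<le> m" "m \<le> d"
  then have "(a, m) \<in> {..d} \<times> {..d}" by simp
  then show "(of_nat a * of_nat (n - 1) / of_nat m - 1) / 2 \<in> resonances n d"
    unfolding resonances_def by (intro UnI2 image_eqI[of _ _ "(a, m)"]) auto
qed

lemma vector_fields_total_degree:
  assumes "X \<in> vector_fields n"
  shows "total_degree (fst X) \<le> n" "total_degree (snd X) \<le> n"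
  using assms by (auto simp: vector_fields_def vf_degree_def)

lemma complex_generic_fields_subset:
  assumes "n \<ge> 2"
  shows "complex_emb.generic_fields \<real> (Suc n) n \<subseteq> Upsilon_complex n \<infinity>"
proof
  fix X assume X: "X \<in> complex_emb.generic_fields \<real> (Suc n) n"
  then have vf: "X \<in> vector_fields n" and gen: "generic_at_infinity \<real> (Suc n) n (coeff_vector n X)"
    by (auto simp: complex_emb.generic_fields_def o_def)
  have "generic_at_infinity \<real> (Suc n) n (vf_coeffs X)"
    by (rule generic_at_infinity_cong[OF _ gen]) (auto simp: coeff_vector_def vf_coeffs_def)
  then show "X \<in> Upsilon_complex n \<infinity>"
    using vf vector_fields_total_degree[OF vf] generic_no_invariant_curve[OF _ _ assms]
    by (auto simp: Upsilon_complex_def)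
qed

lemma real_generic_fields_subset:
  assumes "n \<ge> 2"
  shows "real_emb.generic_fields (resonances n d) d n \<subseteq> Upsilon_real n (enat d)"
proof
  fix X assume X: "X \<in> real_emb.generic_fields (resonances n d) d n"
  then have vf: "X \<in> vector_fields n"
    and gen: "generic_at_infinity (resonances n d) d n (complex_of_real \<circ> coeff_vector n X)"
    by (auto simp: real_emb.generic_fields_def)
  have coeff: "coeff (coeff (map_poly (map_poly complex_of_real) H) j) i = complex_of_real (coeff (coeff H j) i)" for H i j
    by (simp add: coeff_map_poly)
  have "generic_at_infinity (resonances n d) d n (vf_coeffs (complexify X))"
    by (rule generic_at_infinity_cong[OF _ gen])
      (auto simp: coeff_vector_def vf_coeffs_def complexify_def coeff)
  moreover have "total_degree (fst (complexify X)) \<le> n" "total_degree (snd (complexify X)) \<le> n"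
    using vector_fields_total_degree[OF vf] unfolding total_degree_le_iff by (auto simp: complexify_def coeff)
  ultimately have "\<not> (invariant_algebraic_curve (complexify X) G \<and> total_degree G \<le> d)" for G
    using generic_no_invariant_curve_bounded[OF _ _ assms, of "complexify X" "resonances n d" d G]
      resonances_memberI(1) by blast
  then show "X \<in> Upsilon_real n (enat d)"
    using vf by (auto simp: Upsilon_real_def)
qed

theorem theorem2:
  fixes n :: nat
  assumes "n \<ge> 2"
  shows "(\<exists>U. open_dense_in (vf_topology n) U \<and> U \<subseteq> Upsilon_complex n \<infinity>) \<and>
         residual_in (vf_topology n) (Upsilon_real n \<infinity>) \<and>
         (\<forall>d::nat. d \<ge> 1 \<longrightarrow>
           (\<exists>U. open_dense_in (vf_topology n) U \<and> U \<subseteq> Upsilon_real n (enat d))) \<and>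
         full_lebesgue_measure n (Upsilon_complex n \<infinity>) \<and>
         full_lebesgue_measure n (Upsilon_real n \<infinity>) \<and>
         (\<forall>d::nat. d \<ge> 1 \<longrightarrow> full_lebesgue_measure n (Upsilon_real n (enat d)))"
proof -
  define C where "C = complex_emb.generic_fields \<real> (Suc n) n"
  define R where "R d = real_emb.generic_fields (resonances n d) d n" for d
  have real_quot: "(of_nat a * of_nat (n - 1) / of_nat m - 1) / 2 \<in> (\<real> :: complex set)" for a m
    by (intro Reals_divide Reals_diff Reals_mult) auto
  have C: "open_dense_in (vf_topology n) C" "full_lebesgue_measure n C"
    unfolding C_def
    using complex_emb.generic_fields_open_dense_full[OF closed_complex_Reals assms AE_ratio_not_real _ real_quot]
    by auto
  have R: "open_dense_in (vf_topology n) (R d)" "full_lebesgue_measure n (R d)" if "d \<ge> 1" for d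
  proof -
    have "- of_nat 1 / of_nat 1 \<in> resonances n d"
      using that by (intro resonances_memberI(1)) auto
    then have "- 1 \<in> resonances n d" by simp
    from real_emb.generic_fields_open_dense_full[OF closed_resonances assms AE_ratio_not_resonant this resonances_memberI(2)]
    show "open_dense_in (vf_topology n) (R d)" "full_lebesgue_measure n (R d)"
      unfolding R_def by auto
  qed
  have C_sub: "C \<subseteq> Upsilon_complex n \<infinity>"
    unfolding C_def by (rule complex_generic_fields_subset[OF assms])
  have R_sub: "R d \<subseteq> Upsilon_real n (enat d)" for d
    unfolding R_def by (rule real_generic_fields_subset[OF assms])
  \<comment> \<open>The index is \<open>Suc d\<close> because the properties of \<open>R\<close> are
    available from 1 on: -1 is a resonance through a = e = 1, which requires d \<ge> 1.\<close>
  have inter: "vector_fields n \<inter> (\<Inter>d. R (Suc d)) \<subseteq> Upsilon_real n \<infinity>"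
  proof
    fix X assume X: "X \<in> vector_fields n \<inter> (\<Inter>d. R (Suc d))"
    have "\<not> invariant_algebraic_curve (complexify X) G" for G
    proof
      assume G: "invariant_algebraic_curve (complexify X) G"
      have "X \<in> Upsilon_real n (enat (Suc (total_degree G)))"
        using X R_sub by blast
      then show False
        using G by (auto simp: Upsilon_real_def)
    qed
    then show "X \<in> Upsilon_real n \<infinity>"
      using X by (auto simp: Upsilon_real_def)
  qed
  have Upsilon_sub: "Upsilon_real n d \<subseteq> vector_fields n" "Upsilon_complex n d \<subseteq> vector_fields n" for d
    by (auto simp: Upsilon_real_def Upsilon_complex_def)
  have residual: "residual_in (vf_topology n) (Upsilon_real n \<infinity>)"
    unfolding residual_in_def
  proof (intro conjI exI[of _ "range (\<lambda>d. R (Suc d))"])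
    show "topspace (vf_topology n) \<inter> \<Inter> (range (\<lambda>d. R (Suc d))) \<subseteq> Upsilon_real n \<infinity>"
      using inter by simp
  qed (use Upsilon_sub R in auto)
  have full: "full_lebesgue_measure n (Upsilon_real n \<infinity>)"
  proof -
    have "coeff_vector n ` (vector_fields n - Upsilon_real n \<infinity>) \<subseteq>
        (\<Union>d. coeff_vector n ` (vector_fields n - R (Suc d)))"
      using inter by blast
    moreover have "(\<Union>d. coeff_vector n ` (vector_fields n - R (Suc d)))
        \<in> null_sets (completion (PiM (coeff_index n) (\<lambda>_. lborel)))"
      using R(2) unfolding full_lebesgue_measure_def by (intro null_sets_UN) auto
    ultimately have "coeff_vector n ` (vector_fields n - Upsilon_real n \<infinity>)
        \<in> null_sets (completion (PiM (coeff_index n) (\<lambda>_. lborel)))"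
      by (rule completion.complete2)
    then show ?thesis
      unfolding full_lebesgue_measure_def by (intro conjI Upsilon_sub(1))
  qed
  show ?thesis
  proof (intro conjI allI impI residual full)
    show "\<exists>U. open_dense_in (vf_topology n) U \<and> U \<subseteq> Upsilon_complex n \<infinity>"
      using C(1) C_sub by blast
    show "full_lebesgue_measure n (Upsilon_complex n \<infinity>)"
      by (rule full_lebesgue_measure_mono[OF C(2) C_sub Upsilon_sub(2)])
    fix d :: nat
    assume d: "d \<ge> 1"
    show "\<exists>U. open_dense_in (vf_topology n) U \<and> U \<subseteq> Upsilon_real n (enat d)"
      using R(1)[OF d] R_sub by blast
    show "full_lebesgue_measure n (Upsilon_real n (enat d))"
      by (rule full_lebesgue_measure_mono[OF R(2)[OF d] R_sub Upsilon_sub(1)])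
  qed
qed

end
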